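(* Let $p$ be an odd prime and let $p_1$ be any prime number whose residue class generates the cyclic group $(\mathbb{Z}/p)^*$. For $n\ge 1$ put $$\alpha_n=\begin{cases}\alpha_n^{(p_1)}, & \text{if } n \text{ is not divisible by } p-1,\\ \alpha_n^{(p)}, & \text{if } n \text{ is divisible by } p-1,\end{cases}\qquad \alpha_n\in\Omega_U^{-2n}.$$ Then the elements $\alpha_n$, $n=1,2,\ldots$, generate $\widetilde{\Lambda}(1)\otimes\mathbb{Z}_{(p)}$ as an $\Omega_U\otimes\mathbb{Z}_{(p)}$-module.
   Context: $\Omega_U$ is the complex cobordism ring of a point (cobordism ring of stably complex manifolds), graded so that the class of a $2n$-dimensional manifold lies in $\Omega_U^{-2n}$; it is a polynomial ring $\mathbb{Z}[a_1,a_2,\ldots]$ with $\deg a_i=-2i$. $\mathbb{Z}_{(p)}$ is the ring of rational numbers whose denominators are prime to $p$. The formal group law of geometric cobordisms is the (universal) one-dimensional commutative formal group law $F$ over $\Omega_U$ defined by $c_1^U(\xi\otimes\eta)=F(c_1^U(\xi),c_1^U(\eta))$ for complex line bundles $\xi,\eta$, where $c_1^U$ is the first Chern class in complex cobordism. Its logarithm over $\Omega_U\otimes\mathbb{Q}$ is $g(u)=u+\sum_{n\ge1}\frac{[\mathbb{C}P^n]}{n+1}u^{n+1}$. For an integer $k>0$, $[u]_k=g^{-1}(k\,g(u))\in\Omega_U[[u]]$ is the $k$-th power of $u$ in this formal group law. Its coefficients are denoted by $$[u]_k=ku+\sum_{n\ge1}\alpha_n^{(k)}u^{n+1},\qquad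 \alpha_n^{(k)}\in\Omega_U^{-2n}.$$ $\Lambda(1)\subset\Omega_U$ is the subring generated by the coefficients of the series $[u]_k$ for all $k>0$; $\Lambda^+(1)$ is its positive part, consisting of elements of non-zero degree in $\Omega_U$; $\widetilde{\Lambda}(1)=\Lambda^+(1)\cdot\Omega_U$ is the $\Omega_U$-submodule (ideal) of $\Omega_U$ spanned by $\Lambda^+(1)$. Equivalently, $\widetilde{\Lambda}(1)\otimes\mathbb{Z}_{(p)}$ is the ideal of $\Omega_U\otimes\mathbb{Z}_{(p)}$ generated by all $\alpha_n^{(k)}$, $k>1$, $n\ge1$. *)

theory Defs
  imports
    "HOL-Library.Poly_Mapping"
    "HOL-Computational_Algebra.Formal_Power_Series"
    "HOL-Number_Theory.Number_Theory"
begin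

unbundle fps_syntax

text \<open>The library's \<^const>\<open>fps_inv\<close> needs coefficients in a field; for a series with linear coefficient 1
  the same recursion makes sense over any commutative ring.\<close>

fun rev_coeff :: "'a::comm_ring_1 fps \<Rightarrow> nat \<Rightarrow> 'a" where
  "rev_coeff a 0 = 0"
| "rev_coeff a (Suc n) = fps_X $ Suc n - (\<Sum>i = 0..n. rev_coeff a i * (a ^ i) $ Suc n)"

definition fps_rev :: "'a::comm_ring_1 fps \<Rightarrow> 'a fps" where
  "fps_rev a = Abs_fps (rev_coeff a)"

lemma fps_rev_left:
  fixes a :: "'a::comm_ring_1 fps"
  assumes a0: "a $ 0 = 0" and a1: "a $ 1 = 1"
  shows "fps_rev a oo a = fps_X"
proof (rule fps_ext)
  fix n
  show "(fps_rev a oo a) $ n = fps_X $ n"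
  proof (cases n)
    case 0
    then show ?thesis by (simp add: fps_rev_def)
  next
    case (Suc m)
    have "(a ^ Suc m) $ Suc m = 1"
      using startsby_zero_power_nth_same[OF a0, of "Suc m"] a1 by simp
    then have "(fps_rev a oo a) $ Suc m =
        (\<Sum>i = 0..m. rev_coeff a i * (a ^ i) $ Suc m) + rev_coeff a (Suc m)"
      by (simp add: fps_compose_nth fps_rev_def del: power_Suc rev_coeff.simps(2))
    then show ?thesis by (simp add: Suc)
  qed
qed

lemma fps_rev_right:
  fixes a :: "'a::idom fps"
  assumes a0: "a $ 0 = 0" and a1: "a $ 1 = 1"
  shows "a oo fps_rev a = fps_X"
proof -
  let ?b = "fps_rev a"
  have b0: "?b $ 0 = 0" by (simp add: fps_rev_def)
  have b1: "?b $ 1 = 1" by (simp add: fps_rev_def)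
  let ?c = "fps_rev ?b"
  have c0: "?c $ 0 = 0" by (simp add: fps_rev_def)
  have cb: "?c oo ?b = fps_X" by (rule fps_rev_left[OF b0 b1])
  have ba: "?b oo a = fps_X" by (rule fps_rev_left[OF a0 a1])
  have "a = (?c oo ?b) oo a" by (simp add: cb a0)
  also have "\<dots> = ?c oo (?b oo a)" by (rule fps_compose_assoc[OF a0 b0, symmetric])
  also have "\<dots> = ?c" by (simp add: ba)
  finally have "a = ?c" .
  then show ?thesis using cb by simp
qed

text \<open>
  \<open>\<Omega>\<^sub>U\<close> is torsion free, so it is a subring of \<open>\<Omega>\<^sub>U \<otimes> \<rat>\<close>, which is the polynomial ring
  \<open>\<rat>[CP\<^sup>1, CP\<^sup>2, \<dots>]\<close> on the classes of the complex projective spaces (Milnor, Thom).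
  The formal group law of geometric cobordisms is determined over \<open>\<Omega>\<^sub>U \<otimes> \<rat>\<close> by its logarithm
  \<open>g\<close> (Mishchenko), and since it is universal its coefficients generate the ring \<open>\<Omega>\<^sub>U\<close>
  (Quillen).  This presents the pair \<open>(\<Omega>\<^sub>U, F)\<close> inside \<open>\<rat>[CP\<^sup>1, CP\<^sup>2, \<dots>]\<close>.

  The indeterminate with index \<open>i\<close> is \<open>CP\<^sup>i\<^sup>+\<^sup>1\<close>.
\<close>

type_synonym cobordism_rat = "(nat \<Rightarrow>\<^sub>0 nat) \<Rightarrow>\<^sub>0 rat"

definition scalar :: "rat \<Rightarrow> cobordism_rat" where
  "scalar q = Poly_Mapping.single 0 q"

definition CP :: "nat \<Rightarrow> cobordism_rat" where
  "CP n = (if n = 0 then 1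
           else Poly_Mapping.single (Poly_Mapping.single (n - 1) 1) 1)"

text \<open>Complex dimension of a monomial in the \<open>CP\<^sup>i\<close>; its cobordism degree is \<open>-2\<close> times this.\<close>

definition cdim :: "(nat \<Rightarrow>\<^sub>0 nat) \<Rightarrow> nat" where
  "cdim m = (\<Sum>i\<in>Poly_Mapping.keys m. Suc i * Poly_Mapping.lookup m i)"

definition logU :: "cobordism_rat fps" where
  "logU = Abs_fps (\<lambda>n. if n = 0 then 0 else scalar (1 / of_nat n) * CP (n - 1))"

definition expU :: "cobordism_rat fps" where
  "expU = fps_rev logU"

lemma logU_0 [simp]: "logU $ 0 = 0"
  by (simp add: logU_def)

lemma logU_1 [simp]: "logU $ Suc 0 = 1"
  by (simp add: logU_def scalar_def CP_def)

lemma expU_logU: "expU oo logU = fps_X"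
  unfolding expU_def by (rule fps_rev_left) simp_all

lemma logU_expU: "logU oo expU = fps_X"
  unfolding expU_def by (rule fps_rev_right) simp_all

text \<open>
  Power series in two variables \<open>x, y\<close> are series in \<open>y\<close> over series in \<open>x\<close>.  The coefficient of
  \<open>x\<^sup>i y\<^sup>j\<close> in \<open>F(x, y) = g\<^sup>-\<^sup>1(g(x) + g(y))\<close> is given by a finite sum, because
  \<open>(g(x) + g(y))\<^sup>k\<close> has no terms of total degree less than \<open>k\<close>.  (The library's composition
  cannot be used for this iterated power series ring: the inner series \<open>g(x) + g(y)\<close> has the
  nonzero constant coefficient \<open>g(x)\<close> in \<open>y\<close>.)
\<close>

definition in_x :: "'a::comm_ring_1 fps \<Rightarrow> 'a fps fps" where
  "in_x f = fps_const f"

definition in_y :: "'a::comm_ring_1 fps \<Rightarrow> 'a fps fps" where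
  "in_y f = Abs_fps (\<lambda>j. fps_const (f $ j))"

definition fglU :: "nat \<Rightarrow> nat \<Rightarrow> cobordism_rat" where
  "fglU i j = (\<Sum>k\<le>i + j. expU $ k * ((in_x logU + in_y logU) ^ k) $ j $ i)"

definition is_subring :: "'a::comm_ring_1 set \<Rightarrow> bool" where
  "is_subring R \<longleftrightarrow> 1 \<in> R \<and> (\<forall>x\<in>R. \<forall>y\<in>R. x - y \<in> R \<and> x * y \<in> R)"

definition OmegaU :: "cobordism_rat set" where
  "OmegaU = is_subring hull {fglU i j | i j. True}"

definition OmegaU_deg :: "int \<Rightarrow> cobordism_rat set" where
  "OmegaU_deg d = {x \<in> OmegaU. \<forall>m\<in>Poly_Mapping.keys x. - 2 * int (cdim m) = d}"

definition powU :: "nat \<Rightarrow> cobordism_rat fps" where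
  "powU k = expU oo (of_nat k * logU)"

definition alpha :: "nat \<Rightarrow> nat \<Rightarrow> cobordism_rat" where
  "alpha k n = powU k $ (n + 1)"

definition Lambda1 :: "cobordism_rat set" where
  "Lambda1 = is_subring hull {powU k $ i | k i. k > 0}"

text \<open>\<open>\<Lambda>(1)\<close> is a graded subring; its positive part consists of the elements whose
  homogeneous components all have nonzero degree.\<close>

definition Lambda1_pos :: "cobordism_rat set" where
  "Lambda1_pos = {x \<in> Lambda1. \<forall>m\<in>Poly_Mapping.keys x. cdim m \<noteq> 0}"

definition is_submodule :: "'a::comm_ring_1 set \<Rightarrow> 'a set \<Rightarrow> bool" where
  "is_submodule R M \<longleftrightarrow>
     0 \<in> M \<and> (\<forall>x\<in>M. \<forall>y\<in>M. x + y \<in> M) \<and> (\<forall>r\<in>R. \<forall>x\<in>M. r * x \<in> M)"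

definition module_span :: "'a::comm_ring_1 set \<Rightarrow> 'a set \<Rightarrow> 'a set" where
  "module_span R S = is_submodule R hull S"

definition Lambda1_tilde :: "cobordism_rat set" where
  "Lambda1_tilde = module_span OmegaU Lambda1_pos"

definition Z_at :: "nat \<Rightarrow> rat set" where
  "Z_at p = {q. coprime (snd (quotient_of q)) (int p)}"

text \<open>For a subgroup \<open>M\<close> of the rational vector space \<open>\<Omega>\<^sub>U \<otimes> \<rat>\<close>, the map from
  \<open>M \<otimes> \<int>\<^sub>(\<^sub>p\<^sub>)\<close> to \<open>\<Omega>\<^sub>U \<otimes> \<rat>\<close> is injective by flatness, and \<open>M \<otimes> \<int>\<^sub>(\<^sub>p\<^sub>)\<close> is identified with
  its image.\<close>

definition tensor_Z_at :: "cobordism_rat set \<Rightarrow> nat \<Rightarrow> cobordism_rat set" where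
  "tensor_Z_at M p = module_span (scalar ` Z_at p) M"

end

theory Submission
  imports Defs "HOL-Computational_Algebra.Formal_Laurent_Series"
begin

text \<open>Localised at \<open>p\<close>, the ring of cobordism classes is a polynomial ring \<open>\<int>\<^sub>(\<^sub>p\<^sub>)[y\<^sub>2, y\<^sub>3, \<dots>]\<close> on
  generators adapted to \<open>p\<close>, where \<open>y\<^sub>n\<close> has complex dimension \<open>n - 1\<close>.  Following Hazewinkel, they
  are chosen such that the logarithm satisfies the functional equation
  \<open>g(u) = b(u) + 1/p \<Sum>\<^sub>i\<^sub>\<ge>\<^sub>1 y\<^sub>p\<^sub>^\<^sub>i (\<sigma>\<^sup>i g)(u^(p^i))\<close>.  Here \<open>b(u)\<close> is \<open>u\<close> plus the \<open>y\<^sub>n u^n\<close> for those \<open>n > 1\<close> that are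
  not powers of \<open>p\<close>, and \<open>\<sigma>\<close> is the endomorphism with \<open>y\<^sub>n \<mapsto> y\<^sub>n^p\<close>, a lift of Frobenius.  The
  functional equation lemma (\<open>functional_equation_lemma\<close>) says: if \<open>g(E)\<close> satisfies an equation of
  the same shape with \<open>b'\<close> in place of \<open>b\<close>, then \<open>E\<close> is integral, and \<open>b(E)\<close> agrees with \<open>b'\<close>
  modulo the ideal generated by the \<open>y\<^sub>p\<^sub>^\<^sub>i\<close>.

  For \<open>g(E) = g(x) + g(y)\<close> this shows that the formal group law has coefficients in
  \<open>\<int>\<^sub>(\<^sub>p\<^sub>)[y\<^sub>2, y\<^sub>3, \<dots>]\<close>.  Conversely the coefficient of \<open>x\<^sup>i y\<^sup>j\<close> with \<open>i + j = n\<close> is, up to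
  sign and polynomials in lower generators, \<open>n choose j\<close> times \<open>y\<^sub>n\<close>, divided by \<open>p\<close> when \<open>n\<close> is
  a power of \<open>p\<close>; for a suitable \<open>j\<close> this is a unit at \<open>p\<close>.  Hence the generators lie in the
  localised cobordism ring (\<open>tensor_OmegaU_eq_coord_ring\<close>).

  For \<open>g(E) = k g(u)\<close> one has \<open>E = [u]\<^sub>k\<close> and \<open>b' = k b\<close>.  Let \<open>J\<close> be the ideal generated by the
  elements \<open>h\<^sub>n\<close>, where \<open>h\<^sub>n = y\<^sub>n\<close> if \<open>n\<close> is a power of \<open>p\<close> or \<open>p - 1\<close> does not divide \<open>n - 1\<close>, and
  \<open>h\<^sub>n = p y\<^sub>n\<close> otherwise.  The \<open>y\<^sub>n\<close> that survive modulo \<open>J\<close> are annihilated by \<open>p\<close> and satisfy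
  \<open>n \<equiv> 1 (mod p - 1)\<close>, so Fermat's little theorem gives \<open>b(k u) = k b(u)\<close> modulo \<open>J\<close>; together with
  \<open>b([u]\<^sub>k) = k b(u)\<close> this forces \<open>[u]\<^sub>k = k u\<close>, i.e. all the \<open>\<alpha>\<^sub>n\<^sup>(\<^sup>k\<^sup>)\<close> lie in \<open>J\<close>.  Applied
  after setting \<open>y\<^sub>n\<close> and all later generators to zero, the same argument shows that the coefficient
  of \<open>u^n\<close> in \<open>[u]\<^sub>k\<close> is \<open>(k - k^n) y\<^sub>n\<close>, divided by \<open>p\<close> when \<open>n\<close> is a power of \<open>p\<close>, modulo the
  \<open>h\<^sub>m\<close> with \<open>m < n\<close> (\<open>powU_top_generator\<close>).  If \<open>p - 1\<close> divides \<open>n - 1\<close> and \<open>k = p\<close>, or if it does not and \<open>k\<close> is a primitive root, this leading term is a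
  \<open>p\<close>-local unit times \<open>h\<^sub>n\<close>.  By induction on \<open>n\<close> the chosen coefficients generate \<open>J\<close>
  (\<open>ideal_generated_by_powU\<close>).  An element of \<open>\<Lambda>(1)\<close> is an integer plus an element of the ideal
  of the \<open>\<alpha>\<^sub>n\<^sup>(\<^sup>k\<^sup>)\<close>, and the integer vanishes on the positive part; so that ideal is the one in question.\<close>

section \<open>Subrings and ideals\<close>

lemma is_subring_hull: "is_subring (is_subring hull G)"
  by (rule hull_in) (auto simp: is_subring_def)

lemma is_submodule_hull: "is_submodule R (is_submodule R hull G)"
  by (rule hull_in) (auto simp: is_submodule_def)

context
  fixes S :: "'a::comm_ring_1 set"
  assumes S: "is_subring S"
begin

lemma subring_one: "1 \<in> S"
  using S by (simp add: is_subring_def)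

lemma subring_diff: "x \<in> S \<Longrightarrow> y \<in> S \<Longrightarrow> x - y \<in> S"
  using S by (simp add: is_subring_def)

lemma subring_mult: "x \<in> S \<Longrightarrow> y \<in> S \<Longrightarrow> x * y \<in> S"
  using S by (simp add: is_subring_def)

lemma subring_zero: "0 \<in> S"
  using subring_diff[OF subring_one subring_one] by simp

lemma subring_uminus: "x \<in> S \<Longrightarrow> - x \<in> S"
  using subring_diff[OF subring_zero, of x] by simp

lemma subring_add: "x \<in> S \<Longrightarrow> y \<in> S \<Longrightarrow> x + y \<in> S"
  using subring_diff[of x "- y"] subring_uminus[of y] by simp

lemma subring_power: "x \<in> S \<Longrightarrow> x ^ n \<in> S"
  by (induction n) (auto intro: subring_one subring_mult)

lemma subring_of_nat: "of_nat n \<in> S"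
  by (induction n) (auto intro: subring_one subring_zero subring_add)

lemma subring_of_int: "of_int n \<in> S"
  by (cases n) (auto intro: subring_of_nat subring_uminus subring_diff simp del: of_nat_Suc)

lemma subring_sum: "(\<And>i. i \<in> I \<Longrightarrow> f i \<in> S) \<Longrightarrow> sum f I \<in> S"
  by (induction I rule: infinite_finite_induct) (auto intro: subring_zero subring_add)

end

context
  fixes S J :: "'a::comm_ring_1 set"
  assumes J: "is_submodule S J"
begin

lemma submodule_zero: "0 \<in> J"
  using J by (simp add: is_submodule_def)

lemma submodule_add: "x \<in> J \<Longrightarrow> y \<in> J \<Longrightarrow> x + y \<in> J"
  using J by (simp add: is_submodule_def)

lemma submodule_smult: "r \<in> S \<Longrightarrow> x \<in> J \<Longrightarrow> r * x \<in> J"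
  using J by (simp add: is_submodule_def)

lemma submodule_sum: "(\<And>i. i \<in> I \<Longrightarrow> f i \<in> J) \<Longrightarrow> sum f I \<in> J"
  by (induction I rule: infinite_finite_induct) (auto intro: submodule_zero submodule_add)

lemma submodule_uminus:
  assumes "is_subring S" "x \<in> J"
  shows "- x \<in> J"
  using submodule_smult[of "- 1" x] assms subring_uminus[OF assms(1) subring_one[OF assms(1)]]
  by simp

lemma submodule_diff:
  assumes "is_subring S" "x \<in> J" "y \<in> J"
  shows "x - y \<in> J"
  using submodule_add[OF assms(2) submodule_uminus[OF assms(1,3)]] by simp

lemma submodule_smult_right: "x \<in> J \<Longrightarrow> r \<in> S \<Longrightarrow> x * r \<in> J"
  using submodule_smult[of r x] by (simp add: mult.commute)

end

lemma module_span_submodule: "is_submodule R (module_span R G)"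
  unfolding module_span_def by (rule is_submodule_hull)

lemma module_span_inc: "x \<in> G \<Longrightarrow> x \<in> module_span R G"
  unfolding module_span_def by (rule hull_inc)

lemma module_span_minimal: "G \<subseteq> M \<Longrightarrow> is_submodule R M \<Longrightarrow> module_span R G \<subseteq> M"
  unfolding module_span_def by (rule hull_minimal)

lemma module_span_mono: "G \<subseteq> H \<Longrightarrow> module_span R G \<subseteq> module_span R H"
  unfolding module_span_def by (rule hull_mono)

lemma submodule_restrict: "is_submodule R M \<Longrightarrow> R' \<subseteq> R \<Longrightarrow> is_submodule R' M"
  by (auto simp: is_submodule_def)

lemma ideal_in_subring: "is_subring S \<Longrightarrow> G \<subseteq> S \<Longrightarrow> module_span S G \<subseteq> S"
  by (rule module_span_minimal)
     (auto simp: is_submodule_def intro: subring_zero subring_add subring_mult)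

definition multiples :: "'a::comm_ring_1 \<Rightarrow> 'a set \<Rightarrow> 'a set" where
  "multiples a S = (\<lambda>c. a * c) ` S"

lemma multiples_submodule:
  assumes "is_subring S"
  shows "is_submodule S (multiples a S)"
proof -
  have "0 \<in> multiples a S"
    using subring_zero[OF assms] by (auto simp: multiples_def image_iff intro!: bexI[of _ 0])
  moreover have "x + y \<in> multiples a S" if "x \<in> multiples a S" "y \<in> multiples a S" for x y
    using that subring_add[OF assms] by (auto simp: multiples_def distrib_left[symmetric])
  moreover have "r * x \<in> multiples a S" if "r \<in> S" "x \<in> multiples a S" for r x
    using that subring_mult[OF assms] by (auto simp: multiples_def mult.left_commute)
  ultimately show ?thesis by (simp add: is_submodule_def)
qed

lemma multiplesI: "c \<in> S \<Longrightarrow> x = a * c \<Longrightarrow> x \<in> multiples a S"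
  by (auto simp: multiples_def)

lemma multiplesE:
  assumes "x \<in> multiples a S"
  obtains c where "c \<in> S" "x = a * c"
  using assms by (auto simp: multiples_def)

lemma multiples_subset: "is_subring S \<Longrightarrow> a \<in> S \<Longrightarrow> multiples a S \<subseteq> S"
  by (auto simp: multiples_def intro: subring_mult)

lemma ideal_mult_cong:
  assumes S: "is_subring S" and J: "is_submodule S J"
    and "a - b \<in> J" "c - d \<in> J" "c \<in> S" "b \<in> S"
  shows "a * c - b * d \<in> J"
proof -
  have "a * c - b * d = (a - b) * c + b * (c - d)" by (simp add: algebra_simps)
  then show ?thesis
    using submodule_add[OF J submodule_smult_right[OF J] submodule_smult[OF J]] assms by simp
qed

lemma ideal_power_cong:
  assumes S: "is_subring S" and J: "is_submodule S J"
    and "a - b \<in> J" "a \<in> S" "b \<in> S"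
  shows "a ^ n - b ^ n \<in> J"
proof (induction n)
  case (Suc n)
  then show ?case
    using ideal_mult_cong[OF S J \<open>a - b \<in> J\<close> Suc] subring_power[OF S] assms by simp
qed (simp add: submodule_zero[OF J])

definition coeffs_in :: "'a::comm_ring_1 set \<Rightarrow> 'a fps set" where
  "coeffs_in S = {f. \<forall>n. f $ n \<in> S}"

lemma coeffs_inI: "(\<And>n. f $ n \<in> S) \<Longrightarrow> f \<in> coeffs_in S"
  by (simp add: coeffs_in_def)

lemma coeffs_inD: "f \<in> coeffs_in S \<Longrightarrow> f $ n \<in> S"
  by (simp add: coeffs_in_def)

lemma coeffs_in_subring:
  assumes "is_subring S"
  shows "is_subring (coeffs_in S)"
  unfolding is_subring_def coeffs_in_def
  by (auto simp: fps_one_nth fps_mult_nth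
      intro!: subring_one[OF assms] subring_zero[OF assms] subring_diff[OF assms]
        subring_sum[OF assms] subring_mult[OF assms])

lemma coeffs_in_multiples:
  "coeffs_in (multiples (of_nat n) S) = multiples (of_nat n) (coeffs_in S)"
proof (intro equalityI subsetI)
  fix f assume "f \<in> coeffs_in (multiples (of_nat n) S)"
  then have "\<forall>k. \<exists>c. c \<in> S \<and> f $ k = of_nat n * c"
    by (auto simp: coeffs_in_def multiples_def)
  then obtain c where c: "\<And>k. c k \<in> S" "\<And>k. f $ k = of_nat n * c k" by metis
  show "f \<in> multiples (of_nat n) (coeffs_in S)"
    by (rule multiplesI[of "Abs_fps c"])
       (auto simp: coeffs_in_def c fps_eq_iff fps_of_nat[symmetric] simp del: fps_of_nat)
next
  fix f assume "f \<in> multiples (of_nat n) (coeffs_in S)"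
  then show "f \<in> coeffs_in (multiples (of_nat n) S)"
    by (auto simp: coeffs_in_def multiples_def fps_of_nat[symmetric] simp del: fps_of_nat)
qed

section \<open>Power series and coefficient maps\<close>

text \<open>Without constant terms, the coefficient of degree \<open>n\<close> of a power with exponent at least \<open>2\<close>
  only involves coefficients below \<open>n\<close>.  Taking \<open>J = {0}\<close> gives the version for equalities.\<close>

lemma power_nth_cong:
  fixes E E' :: "'a::comm_ring_1 fps"
  assumes S: "is_subring S" and J: "is_submodule S J"
    and E: "E \<in> coeffs_in S" "E' \<in> coeffs_in S" "E $ 0 = 0" "E' $ 0 = 0"
    and eq: "\<And>k. k < n \<Longrightarrow> E $ k - E' $ k \<in> J"
    and m: "m \<ge> 2"
  shows "(E ^ m) $ n - (E' ^ m) $ n \<in> J"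
proof -
  have S': "is_subring (coeffs_in S)" by (rule coeffs_in_subring[OF S])
  have pw: "(E ^ j) $ i \<in> S" "(E' ^ j) $ i \<in> S" for i j
    using subring_power[OF S'] E by (auto intro: coeffs_inD)
  have below: "(E ^ j) $ i - (E' ^ j) $ i \<in> J" if "i < n" for i j
    using that
  proof (induction j arbitrary: i)
    case (Suc j)
    have "(E ^ Suc j) $ i - (E' ^ Suc j) $ i
        = (\<Sum>l=0..i. E $ l * (E ^ j) $ (i - l) - E' $ l * (E' ^ j) $ (i - l))"
      by (simp add: fps_mult_nth sum_subtractf)
    also have "\<dots> \<in> J"
      using Suc by (intro submodule_sum[OF J] ideal_mult_cong[OF S J] eq Suc.IH pw
          coeffs_inD[OF E(2)]) auto
    finally show ?case .
  qed (simp add: submodule_zero[OF J])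
  obtain j where j: "m = Suc j" "j > 0" using m by (cases m) auto
  have zero: "(E ^ j) $ 0 = 0" "(E' ^ j) $ 0 = 0"
    using j E by (auto intro: startsby_zero_power)
  have "(E ^ m) $ n - (E' ^ m) $ n
      = (\<Sum>l=0..n. E $ l * (E ^ j) $ (n - l) - E' $ l * (E' ^ j) $ (n - l))"
    by (simp add: fps_mult_nth sum_subtractf j)
  also have "\<dots> \<in> J"
  proof (rule submodule_sum[OF J])
    fix l assume l: "l \<in> {0..n}"
    consider "l = 0" | "l = n" | "0 < l" "l < n" using l by fastforce
    then show "E $ l * (E ^ j) $ (n - l) - E' $ l * (E' ^ j) $ (n - l) \<in> J"
    proof cases
      case 3
      then show ?thesis
        by (intro ideal_mult_cong[OF S J] eq below pw coeffs_inD[OF E(2)]) auto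
    qed (auto simp: E zero submodule_zero[OF J])
  qed
  finally show ?thesis .
qed

lemma compose_nth_linear:
  fixes f E :: "'a::comm_ring_1 fps"
  assumes "E $ 0 = 0" "n > 0"
  shows "(f oo E) $ n = f $ 1 * E $ n + (\<Sum>k=2..n. f $ k * (E ^ k) $ n)"
proof -
  have "(f oo E) $ n = (\<Sum>k\<in>{0, 1} \<union> {2..n}. f $ k * (E ^ k) $ n)"
    unfolding fps_compose_nth using \<open>n > 0\<close> by (intro sum.cong) auto
  also have "\<dots> = (\<Sum>k\<in>{0, 1}. f $ k * (E ^ k) $ n) + (\<Sum>k=2..n. f $ k * (E ^ k) $ n)"
    by (rule sum.union_disjoint) auto
  finally show ?thesis using \<open>n > 0\<close> by simp
qed

text \<open>Hence the coefficient of degree \<open>n\<close> of \<open>E\<close> enters the one of \<open>f \<circ> E\<close> only linearly.\<close>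

lemma compose_nth_cong:
  fixes f E E' :: "'a::comm_ring_1 fps"
  assumes "E $ 0 = 0" "E' $ 0 = 0" "n > 0" and eq: "\<And>k. k < n \<Longrightarrow> E $ k = E' $ k"
  shows "(f oo E) $ n - f $ 1 * E $ n = (f oo E') $ n - f $ 1 * E' $ n"
proof -
  have "(E ^ k) $ n = (E' ^ k) $ n" if "k \<ge> 2" for k
    using power_nth_cong[of UNIV "{0}" E E' n k] that assms
    by (auto simp: is_subring_def is_submodule_def coeffs_in_def)
  then show ?thesis using assms by (simp add: compose_nth_linear)
qed

definition map_fps :: "('a::zero \<Rightarrow> 'b::zero) \<Rightarrow> 'a fps \<Rightarrow> 'b fps" where
  "map_fps h f = Abs_fps (\<lambda>n. h (f $ n))"

lemma map_fps_nth [simp]: "map_fps h f $ n = h (f $ n)"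
  by (simp add: map_fps_def)

locale comm_ring_hom =
  fixes h :: "'a::comm_ring_1 \<Rightarrow> 'b::comm_ring_1"
  assumes hom_one: "h 1 = 1"
    and hom_add: "h (x + y) = h x + h y"
    and hom_mult: "h (x * y) = h x * h y"
begin

lemma hom_zero: "h 0 = 0"
  using hom_add[of 0 0] by simp

lemma hom_sum: "h (sum f I) = (\<Sum>i\<in>I. h (f i))"
  by (induction I rule: infinite_finite_induct) (auto simp: hom_zero hom_add)

lemma hom_power: "h (x ^ n) = h x ^ n"
  by (induction n) (auto simp: hom_one hom_mult)

lemma hom_of_nat: "h (of_nat n) = of_nat n"
  by (induction n) (auto simp: hom_zero hom_one hom_add)

lemma hom_map_fps: "comm_ring_hom (map_fps h)"
  by unfold_locales (auto simp: fps_eq_iff hom_one hom_zero hom_add hom_mult hom_sum fps_mult_nth)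

lemma map_fps_compose: "map_fps h (f oo g) = map_fps h f oo map_fps h g"
proof (rule fps_ext)
  fix n
  have "h ((g ^ i) $ n) = (map_fps h g ^ i) $ n" for i
    using comm_ring_hom.hom_power[OF hom_map_fps, of g i] by (metis map_fps_nth)
  then show "map_fps h (f oo g) $ n = (map_fps h f oo map_fps h g) $ n"
    by (simp add: fps_compose_nth hom_sum hom_mult)
qed

end

lemma comm_ring_hom_funpow: "comm_ring_hom h \<Longrightarrow> comm_ring_hom ((h ^^ i) :: 'a::comm_ring_1 \<Rightarrow> 'a)"
  by (induction i) (auto simp: comm_ring_hom_def)

section \<open>Lifts of the Frobenius endomorphism\<close>

lemma freshman_cong:
  assumes S: "is_subring S" and p: "prime p" and ab: "a \<in> S" "b \<in> S"
  shows "(a + b) ^ p - (a ^ p + b ^ p) \<in> multiples (of_nat p) S"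
proof (rule multiplesI)
  define c where "c = (\<Sum>k\<in>{1..<p}. of_nat ((p choose k) div p) * a ^ k * b ^ (p - k))"
  show "c \<in> S"
    unfolding c_def
    by (intro subring_sum[OF S] subring_mult[OF S] subring_of_nat[OF S] subring_power[OF S] ab)
  have p0: "p > 0" using p prime_gt_0_nat by blast
  have "(a + b) ^ p = (\<Sum>k\<in>{0, p} \<union> {1..<p}. of_nat (p choose k) * a ^ k * b ^ (p - k))"
    unfolding binomial_ring by (intro sum.cong) auto
  also have "\<dots> = (\<Sum>k\<in>{0, p}. of_nat (p choose k) * a ^ k * b ^ (p - k))
      + (\<Sum>k\<in>{1..<p}. of_nat (p choose k) * a ^ k * b ^ (p - k))"
    by (rule sum.union_disjoint) auto
  also have "(\<Sum>k\<in>{0, p}. of_nat (p choose k) * a ^ k * b ^ (p - k)) = a ^ p + b ^ p"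
    using p0 by (simp add: add.commute)
  also have "(\<Sum>k\<in>{1..<p}. of_nat (p choose k) * a ^ k * b ^ (p - k)) = of_nat p * c"
  proof -
    have "of_nat (p choose k) = (of_nat p * of_nat ((p choose k) div p) :: 'a)"
      if "k \<in> {1..<p}" for k
      using that dvd_choose_prime[of k p] p by (simp flip: of_nat_mult)
    then show ?thesis by (simp add: c_def sum_distrib_left mult.assoc)
  qed
  finally show "(a + b) ^ p - (a ^ p + b ^ p) = of_nat p * c" by simp
qed

text \<open>In the factorisation of \<open>a^p - b^p\<close> by \<open>a - b\<close> the cofactor is congruent to \<open>p b^(p-1)\<close> modulo
  \<open>a - b\<close>, so it contributes one further factor \<open>p\<close>.\<close>

lemma power_prime_cong:
  assumes S: "is_subring S" and e: "e \<ge> 1"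
    and ab: "a \<in> S" "b \<in> S" "a - b \<in> multiples (of_nat (p ^ e)) S"
  shows "a ^ p - b ^ p \<in> multiples (of_nat (p ^ Suc e)) S"
proof -
  let ?J = "multiples (of_nat p) S"
  have J: "is_submodule S ?J" by (rule multiples_submodule[OF S])
  obtain c where c: "c \<in> S" "a - b = of_nat (p ^ e) * c" using ab by (auto elim: multiplesE)
  have "a - b \<in> ?J"
    using c e by (intro multiplesI[of "of_nat (p ^ (e - 1)) * c"] subring_mult[OF S]
        subring_of_nat[OF S]) (simp_all flip: power_Suc mult.assoc)
  then have "(\<Sum>i<p. b ^ (p - Suc i) * a ^ i - b ^ (p - Suc i) * b ^ i) \<in> ?J"
    by (intro submodule_sum[OF J] ideal_mult_cong[OF S J] ideal_power_cong[OF S J] ab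
        subring_power[OF S]) (auto simp: submodule_zero[OF J])
  moreover have "(\<Sum>i<p. b ^ (p - Suc i) * b ^ i) = of_nat p * b ^ (p - 1)"
    by (simp flip: power_add)
  ultimately have "(\<Sum>i<p. b ^ (p - Suc i) * a ^ i) - of_nat p * b ^ (p - 1) \<in> ?J"
    by (simp add: sum_subtractf)
  moreover have "of_nat p * b ^ (p - 1) \<in> ?J"
    by (rule multiplesI[OF subring_power[OF S ab(2)]]) simp
  ultimately have "(\<Sum>i<p. b ^ (p - Suc i) * a ^ i) \<in> ?J"
    using submodule_add[OF J] by fastforce
  then obtain d where d: "d \<in> S" "(\<Sum>i<p. b ^ (p - Suc i) * a ^ i) = of_nat p * d"
    by (auto elim: multiplesE)
  have "a ^ p - b ^ p = (a - b) * (\<Sum>i<p. b ^ (p - Suc i) * a ^ i)"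
    by (rule power_diff_sumr2)
  also have "\<dots> = of_nat (p ^ Suc e) * (c * d)"
    unfolding c d by (simp only: of_nat_mult power_Suc mult_ac)
  finally show ?thesis using c d by (auto intro: multiplesI subring_mult[OF S])
qed

lemma power_multiplicity_cong:
  assumes S: "is_subring S"
    and ab: "a \<in> S" "b \<in> S" "a - b \<in> multiples (of_nat p) S"
  shows "a ^ n - b ^ n \<in> multiples (of_nat (p ^ Suc (multiplicity p n))) S"
proof -
  have "a ^ (p ^ e) - b ^ (p ^ e) \<in> multiples (of_nat (p ^ Suc e)) S" for e
  proof (induction e)
    case (Suc e)
    then show ?case
      using power_prime_cong[OF S _ subring_power[OF S ab(1)] subring_power[OF S ab(2)] Suc]
      by (simp add: mult.commute flip: power_mult)
  qed (use ab in simp)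
  then have "(a ^ (p ^ multiplicity p n)) ^ m - (b ^ (p ^ multiplicity p n)) ^ m
      \<in> multiples (of_nat (p ^ Suc (multiplicity p n))) S" for m
    by (rule ideal_power_cong[OF S multiples_submodule[OF S]])
       (simp_all only: subring_power[OF S] ab)
  moreover obtain m where "n = p ^ multiplicity p n * m"
    using multiplicity_dvd[of p n] by (elim dvdE)
  ultimately show ?thesis by (metis power_mult)
qed

locale frobenius_lift = comm_ring_hom \<sigma> for \<sigma> :: "'a::comm_ring_1 \<Rightarrow> 'a" +
  fixes p :: nat and S :: "'a set"
  assumes prime_p: "prime p" and subring: "is_subring S"
    and lift: "a \<in> S \<Longrightarrow> \<sigma> a - a ^ p \<in> multiples (of_nat p) S"
begin

lemma p_gt_1: "p > 1"
  using prime_p prime_gt_1_nat by blast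

lemma p_multiples_subset: "multiples (of_nat p) S \<subseteq> S"
  by (rule multiples_subset[OF subring subring_of_nat[OF subring]])

lemma p_multiples: "is_submodule S (multiples (of_nat p) S)"
  by (rule multiples_submodule[OF subring])

lemma lift_closed: "a \<in> S \<Longrightarrow> \<sigma> a \<in> S"
  using subring_add[OF subring _ subring_power[OF subring], of "\<sigma> a - a ^ p" a p]
    lift p_multiples_subset by auto

lemma funpow_closed: "a \<in> S \<Longrightarrow> (\<sigma> ^^ i) a \<in> S"
  by (induction i) (auto intro: lift_closed)

lemma funpow_hom: "comm_ring_hom (\<sigma> ^^ i)"
  by (rule comm_ring_hom_funpow) unfold_locales

lemma funpow_lift:
  assumes "a \<in> S"
  shows "(\<sigma> ^^ i) a - a ^ (p ^ i) \<in> multiples (of_nat p) S"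
proof (induction i)
  case (Suc i)
  then obtain c where c: "c \<in> S" "(\<sigma> ^^ i) a - a ^ (p ^ i) = of_nat p * c"
    by (auto elim: multiplesE)
  then have "(\<sigma> ^^ i) a = a ^ (p ^ i) + of_nat p * c" by (simp add: algebra_simps)
  then have "(\<sigma> ^^ Suc i) a = \<sigma> a ^ (p ^ i) + of_nat p * \<sigma> c"
    by (simp add: hom_add hom_mult hom_power hom_of_nat)
  then have "(\<sigma> ^^ Suc i) a - a ^ (p ^ Suc i)
      = (\<sigma> a ^ (p ^ i) - (a ^ p) ^ (p ^ i)) + of_nat p * \<sigma> c"
    by (simp flip: power_mult)
  also have "\<dots> \<in> multiples (of_nat p) S"
    using c assms by (intro submodule_add[OF p_multiples] ideal_power_cong[OF subring p_multiples]
        lift lift_closed subring_power[OF subring] multiplesI[of "\<sigma> c"]) auto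
  finally show ?case .
qed (simp add: submodule_zero[OF p_multiples])

end

definition frob_fps :: "nat \<Rightarrow> ('a \<Rightarrow> 'a) \<Rightarrow> 'a::comm_ring_1 fps \<Rightarrow> 'a fps" where
  "frob_fps p \<sigma> f = map_fps \<sigma> f oo fps_X ^ p"

lemma frob_fps_nth:
  "p > 0 \<Longrightarrow> frob_fps p \<sigma> f $ n = (if p dvd n then \<sigma> (f $ (n div p)) else 0)"
  by (simp add: frob_fps_def fps_nth_compose_X_power)

lemma frob_fps_hom:
  fixes \<sigma> :: "'a::idom \<Rightarrow> 'a"
  assumes "comm_ring_hom \<sigma>" "p > 0"
  shows "comm_ring_hom (frob_fps p \<sigma>)"
proof -
  interpret comm_ring_hom "map_fps \<sigma>" by (rule comm_ring_hom.hom_map_fps) fact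
  show ?thesis
    using \<open>p > 0\<close>
    by unfold_locales
       (simp_all add: frob_fps_def hom_one hom_add hom_mult fps_compose_add_distrib
        fps_compose_mult_distrib)
qed

lemma frob_fps_funpow_nth:
  assumes "p > 0" "comm_ring_hom \<sigma>"
  shows "(frob_fps p \<sigma> ^^ i) f $ n = (if p ^ i dvd n then (\<sigma> ^^ i) (f $ (n div p ^ i)) else 0)"
proof (induction i arbitrary: n)
  case (Suc i)
  have "p ^ Suc i dvd n \<longleftrightarrow> p dvd n \<and> p ^ i dvd n div p"
    using \<open>p > 0\<close> by (auto simp: dvd_div_iff_mult mult.commute dest: dvd_mult_left)
  then show ?case
    using Suc \<open>p > 0\<close> comm_ring_hom.hom_zero[OF \<open>comm_ring_hom \<sigma>\<close>]
    by (simp add: frob_fps_nth div_mult2_eq)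
qed simp

lemma frob_fps_funpow:
  assumes "p > 0" "comm_ring_hom \<sigma>"
  shows "(frob_fps p \<sigma> ^^ i) f = map_fps (\<sigma> ^^ i) f oo fps_X ^ (p ^ i)"
  using assms by (simp add: fps_eq_iff frob_fps_funpow_nth fps_nth_compose_X_power)

text \<open>A lift of Frobenius on \<open>S\<close> extends to power series by \<open>u \<mapsto> u\<^sup>p\<close>.  The defining congruence is
  checked one coefficient at a time, where only a polynomial truncation matters; there it follows
  from the case of monomials by additivity of both sides modulo \<open>p\<close>.\<close>

lemma frobenius_lift_fps:
  fixes \<sigma> :: "'a::idom \<Rightarrow> 'a"
  assumes "frobenius_lift \<sigma> p S"
  shows "frobenius_lift (frob_fps p \<sigma>) p (coeffs_in S)"
proof -
  interpret frobenius_lift \<sigma> p S by fact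
  have p0: "p > 0" using p_gt_1 by simp
  interpret F: comm_ring_hom "frob_fps p \<sigma>"
    using p0 by (intro frob_fps_hom comm_ring_hom_axioms)
  have CS: "is_subring (coeffs_in S)" by (rule coeffs_in_subring[OF subring])
  let ?J = "multiples (of_nat p) (coeffs_in S)"
  have J: "is_submodule (coeffs_in S) ?J" by (rule multiples_submodule[OF CS])
  have monom: "fps_const c * fps_X ^ k \<in> coeffs_in S" if "c \<in> S" for c k
    using that subring_zero[OF subring] by (auto simp: coeffs_in_def)
  have cut: "(\<Sum>k<n. fps_const (f $ k) * fps_X ^ k) \<in> coeffs_in S" if "f \<in> coeffs_in S" for f n
    using that by (intro subring_sum[OF CS] monom coeffs_inD)
  have cut_lift: "frob_fps p \<sigma> (\<Sum>k<n. fps_const (f $ k) * fps_X ^ k)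
      - (\<Sum>k<n. fps_const (f $ k) * fps_X ^ k) ^ p \<in> ?J" if f: "f \<in> coeffs_in S" for f n
  proof (induction n)
    case 0
    then show ?case using p0 submodule_zero[OF J] F.hom_zero by (simp add: power_0_left)
  next
    case (Suc n)
    define g where "g = (\<Sum>k<n. fps_const (f $ k) * fps_X ^ k)"
    define t where "t = fps_const (f $ n) * fps_X ^ n"
    have gS: "g \<in> coeffs_in S" unfolding g_def by (rule cut[OF f])
    have tS: "t \<in> coeffs_in S" unfolding t_def by (intro monom coeffs_inD f)
    have "frob_fps p \<sigma> t = fps_const (\<sigma> (f $ n)) * fps_X ^ (n * p)"
      using p0 by (intro fps_ext) (auto simp: frob_fps_nth t_def fps_X_power_iff hom_zero)
    then have "frob_fps p \<sigma> t - t ^ p = fps_const (\<sigma> (f $ n) - (f $ n) ^ p) * fps_X ^ (n * p)"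
      by (simp add: t_def power_mult_distrib power_mult algebra_simps fps_const_power
          flip: fps_const_sub)
    moreover obtain c where "c \<in> S" "\<sigma> (f $ n) - (f $ n) ^ p = of_nat p * c"
      using lift[OF coeffs_inD[OF f]] by (auto elim: multiplesE)
    ultimately have "frob_fps p \<sigma> t - t ^ p = of_nat p * (fps_const c * fps_X ^ (n * p))"
      by (simp flip: fps_const_mult fps_of_nat mult.assoc)
    then have "frob_fps p \<sigma> t - t ^ p \<in> ?J"
      using \<open>c \<in> S\<close> by (intro multiplesI[OF monom])
    then have "(frob_fps p \<sigma> g - g ^ p) + (frob_fps p \<sigma> t - t ^ p)
        - ((g + t) ^ p - (g ^ p + t ^ p)) \<in> ?J"
      using Suc unfolding g_def[symmetric]
      by (intro submodule_add[OF J, of "_ - _" "_ - _"]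
        submodule_diff[OF J CS, of "_ + _"] freshman_cong[OF CS prime_p] gS tS)
    moreover have "(\<Sum>k<Suc n. fps_const (f $ k) * fps_X ^ k) = g + t"
      by (simp add: g_def t_def)
    ultimately show ?case by (simp only: F.hom_add) (simp add: algebra_simps)
  qed
  have "frob_fps p \<sigma> f - f ^ p \<in> ?J" if f: "f \<in> coeffs_in S" for f
  proof -
    have "(frob_fps p \<sigma> f - f ^ p) $ n \<in> multiples (of_nat p) S" for n
    proof -
      define g where "g = (\<Sum>k<Suc n. fps_const (f $ k) * fps_X ^ k)"
      have g: "g $ k = (if k < Suc n then f $ k else 0)" for k
        by (simp add: g_def fps_sum_nth fps_X_power_iff if_distrib sum.delta cong: if_cong)
      have "(f ^ j) $ k = (g ^ j) $ k" if "k \<le> n" for j k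
        using that by (induction j arbitrary: k) (simp_all add: fps_mult_nth g)
      moreover have "frob_fps p \<sigma> f $ n = frob_fps p \<sigma> g $ n"
        using p0 by (simp add: frob_fps_nth g le_imp_less_Suc)
      ultimately have "(frob_fps p \<sigma> f - f ^ p) $ n = (frob_fps p \<sigma> g - g ^ p) $ n" by simp
      then show ?thesis
        using cut_lift[OF f, of "Suc n"] unfolding g_def[symmetric]
        by (auto simp flip: coeffs_in_multiples dest: coeffs_inD)
    qed
    then show ?thesis by (auto simp flip: coeffs_in_multiples intro: coeffs_inI)
  qed
  then show ?thesis by unfold_locales (use prime_p CS in auto)
qed

section \<open>The functional equation lemma\<close>

text \<open>The coefficientwise form of \<open>f(u) = b(u) + \<pi> \<Sum>\<^sub>i\<^sub>\<ge>\<^sub>1 v\<^sub>i (\<sigma>\<^sup>i f)(u^(p^i))\<close>, to be used with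
  \<open>\<pi> = 1/p\<close>.  The bound \<open>i \<le> n\<close> loses nothing for \<open>p > 1\<close>, as \<open>p^i\<close> can only divide \<open>n > 0\<close>
  if \<open>i < n\<close>.\<close>

definition functional_eq ::
  "nat \<Rightarrow> 'a \<Rightarrow> ('a \<Rightarrow> 'a) \<Rightarrow> (nat \<Rightarrow> 'a) \<Rightarrow> 'a fps \<Rightarrow> 'a::comm_ring_1 fps \<Rightarrow> bool" where
  "functional_eq p \<pi> \<sigma> v b f \<longleftrightarrow>
     (\<forall>n. f $ n = b $ n + \<pi> * (\<Sum>i | i \<in> {1..n} \<and> p ^ i dvd n. v i * (\<sigma> ^^ i) (f $ (n div p ^ i))))"

lemma functional_eqD:
  "functional_eq p \<pi> \<sigma> v b f \<Longrightarrow>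
     f $ n = b $ n + \<pi> * (\<Sum>i | i \<in> {1..n} \<and> p ^ i dvd n. v i * (\<sigma> ^^ i) (f $ (n div p ^ i)))"
  unfolding functional_eq_def by blast

lemma power_dvd_imp_less:
  fixes p n i :: nat
  assumes "p > 1" "n > 0" "i > 0" "p ^ i dvd n"
  shows "n div p ^ i < n" "0 < n div p ^ i" "i < n"
proof -
  have "p ^ i > 1" using assms by (intro one_less_power) auto
  then show "n div p ^ i < n" using assms by simp
  show "0 < n div p ^ i"
    using assms by (metis dvd_div_eq_0_iff gr0I)
  have "i < 2 ^ i" by (rule less_exp)
  also have "(2::nat) ^ i \<le> p ^ i" using assms by (intro power_mono) auto
  also have "p ^ i \<le> n" using assms by (intro dvd_imp_le)
  finally show "i < n" .
qed

function functional_eq_coeff ::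
  "nat \<Rightarrow> 'a \<Rightarrow> ('a \<Rightarrow> 'a) \<Rightarrow> (nat \<Rightarrow> 'a) \<Rightarrow> 'a::comm_ring_1 fps \<Rightarrow> nat \<Rightarrow> 'a" where
  "functional_eq_coeff p \<pi> \<sigma> v b n = b $ n + \<pi> * (\<Sum>i | i \<in> {1..n} \<and> p ^ i dvd n \<and> 1 < p.
     v i * (\<sigma> ^^ i) (functional_eq_coeff p \<pi> \<sigma> v b (n div p ^ i)))"
  by pat_completeness auto
termination
  by (relation "measure (\<lambda>(_, _, _, _, _, n). n)") (auto intro: power_dvd_imp_less(1))

declare functional_eq_coeff.simps [simp del]

lemma functional_eq_solution:
  "p > 1 \<Longrightarrow> functional_eq p \<pi> \<sigma> v b (Abs_fps (functional_eq_coeff p \<pi> \<sigma> v b))"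
  unfolding functional_eq_def
  by (intro allI, simp, subst functional_eq_coeff.simps) simp

lemma functional_eq_nth_0: "functional_eq p \<pi> \<sigma> v b f \<Longrightarrow> f $ 0 = b $ 0"
  by (subst functional_eqD) auto

lemma functional_eq_nth_1:
  assumes "functional_eq p \<pi> \<sigma> v b f" "p > 1"
  shows "f $ 1 = b $ 1"
proof -
  have empty: "{i. i \<in> {1..1} \<and> p ^ i dvd 1} = {}" using assms(2) by auto
  show ?thesis using functional_eqD[OF assms(1), of 1] unfolding empty by simp
qed

lemma functional_eq_add:
  assumes "comm_ring_hom \<sigma>" "functional_eq p \<pi> \<sigma> v b f" "functional_eq p \<pi> \<sigma> v c g"
  shows "functional_eq p \<pi> \<sigma> v (b + c) (f + g)"
  unfolding functional_eq_def fps_add_nth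
    comm_ring_hom.hom_add[OF comm_ring_hom_funpow[OF assms(1)]] distrib_left sum.distrib
  by (intro allI, subst functional_eqD[OF assms(2)], subst functional_eqD[OF assms(3)])
     (simp only: add_ac)

lemma functional_eq_of_nat:
  assumes "comm_ring_hom \<sigma>" "functional_eq p \<pi> \<sigma> v b f"
  shows "functional_eq p \<pi> \<sigma> v (of_nat k * b) (of_nat k * f)"
proof (induction k)
  case 0
  then show ?case
    using comm_ring_hom.hom_zero[OF comm_ring_hom_funpow[OF assms(1)]]
    by (simp add: functional_eq_def)
next
  case (Suc k)
  then show ?case using functional_eq_add[OF assms Suc] by (simp add: distrib_right)
qed

context frobenius_lift
begin

text \<open>Each step of the recursion divides by \<open>p\<close> once and passes from \<open>n\<close> to \<open>n / p^i\<close> with \<open>i > 0\<close>, so at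
  most as many factors \<open>p\<close> accumulate in the denominator as \<open>n\<close> contains.\<close>

lemma functional_eq_denominator:
  assumes f: "functional_eq p \<pi> \<sigma> v b f" and \<pi>: "of_nat p * \<pi> = 1"
    and v: "\<And>i. i > 0 \<Longrightarrow> v i \<in> S" and b: "b \<in> coeffs_in S"
    and n: "n > 0"
  shows "of_nat (p ^ multiplicity p n) * f $ n \<in> S"
  using n
proof (induction n rule: less_induct)
  case (less n)
  let ?m = "multiplicity p n"
  have "of_nat (p ^ ?m) * (\<pi> * (v i * (\<sigma> ^^ i) (f $ (n div p ^ i)))) \<in> S"
    if i: "i \<in> {1..n}" "p ^ i dvd n" for i
  proof -
    let ?k = "n div p ^ i"
    interpret I: comm_ring_hom "\<sigma> ^^ i" by (rule funpow_hom)
    have im: "i \<le> ?m" using i less.prems p_gt_1 by (intro multiplicity_geI) auto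
    have "multiplicity p (p ^ i * ?k) = i + multiplicity p ?k"
      using p_gt_1 power_dvd_imp_less(2)[OF p_gt_1 less.prems _ i(2)] i(1) prime_p
      by (simp add: prime_elem_multiplicity_mult_distrib prime_elem_multiplicity_power_distrib
          prime_imp_prime_elem)
    then have mk: "?m = i + multiplicity p ?k" using i(2) by simp
    have "p ^ ?m = p * p ^ (i - 1) * p ^ multiplicity p ?k"
      using mk i(1) by (simp add: power_add flip: power_Suc)
    then have "of_nat (p ^ ?m) * (\<pi> * (v i * (\<sigma> ^^ i) (f $ ?k)))
        = (of_nat p * \<pi>) * (of_nat (p ^ (i - 1)) * (v i *
            (of_nat (p ^ multiplicity p ?k) * (\<sigma> ^^ i) (f $ ?k))))"
      by (simp only: of_nat_mult mult_ac)
    also have "\<dots> = of_nat (p ^ (i - 1)) * (v i *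
            (\<sigma> ^^ i) (of_nat (p ^ multiplicity p ?k) * f $ ?k))"
      by (simp only: \<pi> I.hom_mult I.hom_of_nat mult_1_left)
    also have "\<dots> \<in> S"
      using i power_dvd_imp_less[OF p_gt_1 less.prems _ i(2)]
      by (intro subring_mult[OF subring] subring_of_nat[OF subring] v funpow_closed less.IH) auto
    finally show ?thesis .
  qed
  then show ?case
    unfolding functional_eqD[OF f, of n] distrib_left sum_distrib_left
    by (intro subring_add[OF subring] subring_sum[OF subring] subring_mult[OF subring _ coeffs_inD[OF b]]
        subring_of_nat[OF subring]) blast
qed

end

text \<open>Subtracting the equations for \<open>f\<close>, evaluated at \<open>E\<close>, and for \<open>w = f \<circ> E\<close> expresses
  \<open>b \<circ> E - b'\<close> as the sum of the \<open>\<pi> v\<^sub>i\<close> times the differences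
  \<open>(\<sigma>\<^sup>i f)((\<sigma>\<^sup>i E)(u^(p^i))) - (\<sigma>\<^sup>i f)(E^(p^i))\<close>.  The two arguments agree modulo \<open>p\<close>, so their
  \<open>n\<close>-th powers agree modulo \<open>p q\<close>, where \<open>q\<close> is the exact power of \<open>p\<close> in \<open>n\<close>, and \<open>q\<close>
  clears the denominator of the \<open>n\<close>-th coefficient of \<open>f\<close>.  The differences are therefore divisible
  by \<open>p\<close>, which cancels \<open>\<pi>\<close>.  In degree \<open>n\<close> they only use coefficients of \<open>E\<close> in lower degree,
  so \<open>E\<close> is integral by induction on \<open>n\<close>.\<close>

theorem functional_equation_lemma:
  fixes \<sigma> :: "'a::idom \<Rightarrow> 'a"
  assumes fl: "frobenius_lift \<sigma> p S" and \<pi>: "of_nat p * \<pi> = 1"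
    and v: "\<And>i. i > 0 \<Longrightarrow> v i \<in> S"
    and b: "b \<in> coeffs_in S" "b $ 0 = 0" "b $ 1 = 1" and b': "b' \<in> coeffs_in S" "b' $ 0 = 0"
    and f: "functional_eq p \<pi> \<sigma> v b f" and w: "functional_eq p \<pi> \<sigma> v b' w"
    and E: "E $ 0 = 0" "f oo E = w"
  shows "E \<in> coeffs_in S" and "(b oo E) $ n - b' $ n \<in> module_span S {v i | i. i > 0}"
proof -
  interpret frobenius_lift \<sigma> p S by fact
  have p0: "p > 0" using p_gt_1 by simp
  define \<Phi> where "\<Phi> = frob_fps p \<sigma>"
  interpret F: frobenius_lift \<Phi> p "coeffs_in S"
    unfolding \<Phi>_def by (rule frobenius_lift_fps[OF fl])
  have \<Phi>_nth: "(\<Phi> ^^ i) g $ n = (if p ^ i dvd n then (\<sigma> ^^ i) (g $ (n div p ^ i)) else 0)"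
    for i g n
    unfolding \<Phi>_def by (rule frob_fps_funpow_nth[OF p0 comm_ring_hom_axioms])
  have \<Phi>_eq: "(\<Phi> ^^ i) g = map_fps (\<sigma> ^^ i) g oo fps_X ^ (p ^ i)" for i g
    unfolding \<Phi>_def by (rule frob_fps_funpow[OF p0 comm_ring_hom_axioms])
  have f0: "f $ 0 = 0" and f1: "f $ 1 = 1"
  proof -
    show "f $ 0 = 0" using functional_eqD[OF f, of 0] b by simp
    have empty: "{i. i \<in> {1..1} \<and> p ^ i dvd 1} = {}" using p_gt_1 by auto
    show "f $ 1 = 1" using functional_eqD[OF f, of 1] b unfolding empty by simp
  qed
  have rhs: "(\<Sum>i | i \<in> {1..n} \<and> p ^ i dvd n. v i * (\<sigma> ^^ i) (g $ (n div p ^ i)))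
      = (\<Sum>i=1..n. v i * (\<Phi> ^^ i) g $ n)" for g n
    by (intro sum.mono_neutral_cong_left) (auto simp: \<Phi>_nth)
  \<comment> \<open>the difference of the two functional equations in degree \<open>n\<close>, for a truncation \<open>E'\<close>\<close>
  have key: "E $ n = b' $ n - (b oo E') $ n + \<pi> * (\<Sum>i=1..n. v i *
      ((map_fps (\<sigma> ^^ i) f oo (\<Phi> ^^ i) E') $ n - (map_fps (\<sigma> ^^ i) f oo E' ^ (p ^ i)) $ n))"
    if n: "n > 0" and E': "E' = fps_cutoff n E" for n E'
  proof -
    have E'0: "E' $ 0 = 0" using E by (simp add: E')
    have fE: "(f oo E) $ m = (f oo E') $ m" if "m < n" for m
      using compose_nth_cong[of E E' m f] that E E'0 by (cases "m = 0") (auto simp: E')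
    have fEn: "(f oo E) $ n = (f oo E') $ n + E $ n"
      using compose_nth_cong[of E E' n f] n E E'0 f1 by (simp add: E' algebra_simps)
    define g where "g = b + fps_const \<pi> * (\<Sum>i=1..n. fps_const (v i) * (\<Phi> ^^ i) f)"
    have g: "f $ m = g $ m" if "m \<le> n" for m
    proof -
      have "(\<Sum>i=1..m. v i * (\<Phi> ^^ i) f $ m) = (\<Sum>i=1..n. v i * (\<Phi> ^^ i) f $ m)"
      proof (intro sum.mono_neutral_left)
        show "\<forall>i\<in>{1..n} - {1..m}. v i * (\<Phi> ^^ i) f $ m = 0"
        proof
          fix i assume i: "i \<in> {1..n} - {1..m}"
          then have "m = 0 \<or> \<not> p ^ i dvd m"
            using power_dvd_imp_less(3)[OF p_gt_1, of m i] by auto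
          then show "v i * (\<Phi> ^^ i) f $ m = 0"
            using f0 by (auto simp: \<Phi>_nth comm_ring_hom.hom_zero[OF funpow_hom])
        qed
      qed (use that in auto)
      then show ?thesis unfolding functional_eqD[OF f, of m] rhs by (simp add: g_def fps_sum_nth)
    qed
    have "(f oo E') $ n = (g oo E') $ n" by (simp add: fps_compose_nth g)
    also have "\<dots> = (b oo E') $ n + \<pi> * (\<Sum>i=1..n. v i * ((\<Phi> ^^ i) f oo E') $ n)"
      using E'0 by (simp add: g_def fps_compose_add_distrib fps_compose_mult_distrib
          fps_compose_sum_distrib fps_sum_nth)
    also have "(\<lambda>i. (\<Phi> ^^ i) f oo E') = (\<lambda>i. map_fps (\<sigma> ^^ i) f oo E' ^ (p ^ i))"
      using E'0 p0 unfolding \<Phi>_eq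
      by (simp add: fps_compose_assoc[symmetric] fps_X_power_compose)
    finally have 1: "(f oo E') $ n = (b oo E') $ n
      + \<pi> * (\<Sum>i=1..n. v i * (map_fps (\<sigma> ^^ i) f oo E' ^ (p ^ i)) $ n)" .
    have "w $ n = b' $ n + \<pi> * (\<Sum>i=1..n. v i * (\<Phi> ^^ i) w $ n)"
      unfolding functional_eqD[OF w, of n] rhs ..
    also have "(\<Sum>i=1..n. v i * (\<Phi> ^^ i) w $ n) = (\<Sum>i=1..n. v i * (\<Phi> ^^ i) (f oo E') $ n)"
      using power_dvd_imp_less(1)[OF p_gt_1 n]
      by (intro sum.cong) (auto simp: \<Phi>_nth fE E(2)[symmetric])
    also have "(\<lambda>i. (\<Phi> ^^ i) (f oo E')) = (\<lambda>i. map_fps (\<sigma> ^^ i) f oo (\<Phi> ^^ i) E')"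
      using E'0 p0 unfolding \<Phi>_eq
      by (simp add: comm_ring_hom.map_fps_compose[OF funpow_hom] fps_compose_assoc
          comm_ring_hom.hom_zero[OF funpow_hom])
    finally have 2: "w $ n = b' $ n + \<pi> * (\<Sum>i=1..n. v i * (map_fps (\<sigma> ^^ i) f oo (\<Phi> ^^ i) E') $ n)" .
    show ?thesis
      using 1 2 fEn unfolding E(2)
      by (simp only: right_diff_distrib sum_subtractf) (simp add: algebra_simps)
  qed
  have diff: "\<pi> * ((map_fps (\<sigma> ^^ i) f oo (\<Phi> ^^ i) E') $ n - (map_fps (\<sigma> ^^ i) f oo E' ^ (p ^ i)) $ n) \<in> S"
    if E': "E' \<in> coeffs_in S" for E' i n
  proof -
    have "(\<sigma> ^^ i) (f $ k) * ((((\<Phi> ^^ i) E') ^ k) $ n - ((E' ^ (p ^ i)) ^ k) $ n) \<in> multiples (of_nat p) S"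
      for k
    proof (cases "k = 0")
      case False
      let ?m = "p ^ multiplicity p k"
      have "((\<Phi> ^^ i) E') ^ k - (E' ^ (p ^ i)) ^ k \<in> multiples (of_nat (p * ?m)) (coeffs_in S)"
        using power_multiplicity_cong[OF F.subring F.funpow_closed[OF E']
            subring_power[OF F.subring E'] F.funpow_lift[OF E']] by simp
      then have "(((\<Phi> ^^ i) E') ^ k) $ n - ((E' ^ (p ^ i)) ^ k) $ n \<in> multiples (of_nat (p * ?m)) S"
        unfolding coeffs_in_multiples[symmetric] fps_sub_nth[symmetric] by (rule coeffs_inD)
      then obtain c where c: "c \<in> S"
        "(((\<Phi> ^^ i) E') ^ k) $ n - ((E' ^ (p ^ i)) ^ k) $ n = of_nat (p * ?m) * c"
        by (auto elim: multiplesE)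
      interpret I: comm_ring_hom "\<sigma> ^^ i" by (rule funpow_hom)
      have "(\<sigma> ^^ i) (of_nat ?m * f $ k) \<in> S"
        using False by (intro funpow_closed functional_eq_denominator[OF f \<pi> v b(1)]) auto
      then have "of_nat ?m * (\<sigma> ^^ i) (f $ k) \<in> S"
        by (simp only: I.hom_mult I.hom_of_nat)
      then show ?thesis
        unfolding c(2)
        by (rule multiplesI[OF subring_mult[OF subring _ c(1)]]) (simp only: of_nat_mult mult_ac)
    qed (simp add: submodule_zero[OF p_multiples])
    then have "(map_fps (\<sigma> ^^ i) f oo (\<Phi> ^^ i) E') $ n - (map_fps (\<sigma> ^^ i) f oo E' ^ (p ^ i)) $ n
        \<in> multiples (of_nat p) S"
      unfolding fps_compose_nth map_fps_nth sum_subtractf[symmetric] right_diff_distrib[symmetric]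
      by (intro submodule_sum[OF p_multiples])
    then obtain c where "c \<in> S" "(map_fps (\<sigma> ^^ i) f oo (\<Phi> ^^ i) E') $ n
        - (map_fps (\<sigma> ^^ i) f oo E' ^ (p ^ i)) $ n = of_nat p * c"
      by (auto elim: multiplesE)
    then show ?thesis using \<pi> by (simp add: mult.commute[of \<pi>] flip: mult.assoc)
  qed
  have Vsub: "module_span S {v i | i. i > 0} \<subseteq> S"
    by (rule ideal_in_subring[OF subring]) (use v in auto)
  have corr: "\<pi> * (\<Sum>i=1..n. v i *
      ((map_fps (\<sigma> ^^ i) f oo (\<Phi> ^^ i) E') $ n - (map_fps (\<sigma> ^^ i) f oo E' ^ (p ^ i)) $ n))
      \<in> module_span S {v i | i. i > 0}" if E': "E' \<in> coeffs_in S" for E' n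
    unfolding sum_distrib_left
  proof (intro submodule_sum[OF module_span_submodule])
    fix i assume "i \<in> {1..n}"
    then have "v i \<in> module_span S {v i | i. i > 0}"
      by (intro module_span_inc) auto
    then show "\<pi> * (v i * ((map_fps (\<sigma> ^^ i) f oo (\<Phi> ^^ i) E') $ n - (map_fps (\<sigma> ^^ i) f oo E' ^ (p ^ i)) $ n))
      \<in> module_span S {v i | i. i > 0}"
      unfolding mult.left_commute[of \<pi> "v i"]
      by (rule submodule_smult_right[OF module_span_submodule _ diff[OF E']])
  qed
  have ES: "E $ n \<in> S" for n
  proof (induction n rule: less_induct)
    case (less n)
    define E' where "E' = fps_cutoff n E"
    have E': "E' \<in> coeffs_in S"
      using less by (auto simp: E'_def coeffs_in_def subring_zero[OF subring])
    show ?case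
    proof (cases "n = 0")
      case False
      have "(b oo E') $ n \<in> S"
        unfolding fps_compose_nth
        by (intro subring_sum[OF subring] subring_mult[OF subring] coeffs_inD[OF b(1)]
            coeffs_inD[OF subring_power[OF F.subring E']])
      then show ?thesis
        using key[OF _ E'_def] False Vsub corr[OF E', of n] coeffs_inD[OF b'(1)]
        by (auto intro!: subring_add[OF subring] subring_diff[OF subring])
    qed (simp add: E subring_zero[OF subring])
  qed
  show 1: "E \<in> coeffs_in S" using ES by (rule coeffs_inI)
  show "(b oo E) $ n - b' $ n \<in> module_span S {v i | i. i > 0}"
  proof (cases "n = 0")
    case False
    define E' where "E' = fps_cutoff n E"
    have E': "E' \<in> coeffs_in S"
      using ES by (auto simp: E'_def coeffs_in_def subring_zero[OF subring])
    have "(b oo E) $ n = (b oo E') $ n + E $ n"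
      using compose_nth_cong[of E E' n b] False E b by (simp add: E'_def algebra_simps)
    then show ?thesis using key[OF _ E'_def] False corr[OF E', of n] by simp
  qed (simp add: b b' submodule_zero[OF module_span_submodule])
qed

section \<open>Substitution in the ring of rational cobordism classes\<close>

lemma scalar_add: "scalar (a + b) = scalar a + scalar b"
  by (simp add: scalar_def single_add)

lemma scalar_mult: "scalar (a * b) = scalar a * scalar b"
  by (simp add: scalar_def mult_single)

lemma scalar_uminus: "scalar (- a) = - scalar a"
  by (simp add: scalar_def single_uminus)

lemma scalar_0 [simp]: "scalar 0 = 0"
  by (simp add: scalar_def)

lemma scalar_1 [simp]: "scalar 1 = 1"
  by (simp add: scalar_def)

lemma scalar_of_nat: "scalar (of_nat n) = of_nat n"
  by (simp add: scalar_def)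

lemma scalar_diff: "scalar (a - b) = scalar a - scalar b"
  by (simp add: scalar_def single_diff)

lemma scalar_power: "scalar q ^ n = scalar (q ^ n)"
  by (induction n) (simp_all add: scalar_mult)

lemma scalar_inverse: "n > 0 \<Longrightarrow> of_nat n * scalar (1 / of_nat n) = 1"
  by (simp flip: scalar_of_nat scalar_mult)

text \<open>The Frobenius lift will be defined by prescribing its values on the projective spaces, which is
  possible because they are polynomial generators over the rationals.\<close>

definition monom_eval :: "(nat \<Rightarrow> cobordism_rat) \<Rightarrow> (nat \<Rightarrow>\<^sub>0 nat) \<Rightarrow> cobordism_rat" where
  "monom_eval f m = (\<Prod>i\<in>Poly_Mapping.keys m. f i ^ Poly_Mapping.lookup m i)"

definition eval_at :: "(nat \<Rightarrow> cobordism_rat) \<Rightarrow> cobordism_rat \<Rightarrow> cobordism_rat" where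
  "eval_at f x = (\<Sum>m\<in>Poly_Mapping.keys x. scalar (Poly_Mapping.lookup x m) * monom_eval f m)"

lemma monom_eval_superset:
  "finite T \<Longrightarrow> Poly_Mapping.keys m \<subseteq> T \<Longrightarrow> monom_eval f m = (\<Prod>i\<in>T. f i ^ Poly_Mapping.lookup m i)"
  unfolding monom_eval_def by (intro prod.mono_neutral_left) (auto simp: in_keys_iff)

lemma monom_eval_add: "monom_eval f (m + n) = monom_eval f m * monom_eval f n"
proof -
  let ?T = "Poly_Mapping.keys m \<union> Poly_Mapping.keys n"
  have "monom_eval f (m + n) = (\<Prod>i\<in>?T. f i ^ Poly_Mapping.lookup (m + n) i)"
    by (rule monom_eval_superset) (use keys_add[of m n] in auto)
  also have "\<dots> = (\<Prod>i\<in>?T. f i ^ Poly_Mapping.lookup m i) * (\<Prod>i\<in>?T. f i ^ Poly_Mapping.lookup n i)"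
    by (simp add: lookup_add power_add prod.distrib)
  also have "\<dots> = monom_eval f m * monom_eval f n"
    by (simp add: monom_eval_superset[of ?T])
  finally show ?thesis .
qed

lemma eval_at_superset:
  "finite T \<Longrightarrow> Poly_Mapping.keys x \<subseteq> T \<Longrightarrow> eval_at f x = (\<Sum>m\<in>T. scalar (Poly_Mapping.lookup x m) * monom_eval f m)"
  unfolding eval_at_def by (intro sum.mono_neutral_left) (auto simp: in_keys_iff)

lemma eval_at_add: "eval_at f (x + y) = eval_at f x + eval_at f y"
proof -
  let ?T = "Poly_Mapping.keys x \<union> Poly_Mapping.keys y"
  have "eval_at f (x + y) = (\<Sum>m\<in>?T. scalar (Poly_Mapping.lookup (x + y) m) * monom_eval f m)"
    by (rule eval_at_superset) (use keys_add[of x y] in auto)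
  also have "\<dots> = (\<Sum>m\<in>?T. scalar (Poly_Mapping.lookup x m) * monom_eval f m)
      + (\<Sum>m\<in>?T. scalar (Poly_Mapping.lookup y m) * monom_eval f m)"
    by (simp add: lookup_add scalar_add distrib_right sum.distrib)
  also have "\<dots> = eval_at f x + eval_at f y"
    by (simp add: eval_at_superset[of ?T])
  finally show ?thesis .
qed

lemma eval_at_single: "eval_at f (Poly_Mapping.single m q) = scalar q * monom_eval f m"
  by (cases "q = 0") (simp_all add: eval_at_def)

lemma eval_at_sum: "eval_at f (sum g I) = (\<Sum>i\<in>I. eval_at f (g i))"
  by (induction I rule: infinite_finite_induct) (simp_all add: eval_at_add eval_at_def[of _ 0])

lemma sum_of_monomials:
  fixes x :: cobordism_rat
  shows "x = (\<Sum>m\<in>Poly_Mapping.keys x. Poly_Mapping.single m (Poly_Mapping.lookup x m))"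
  by (rule poly_mapping_eqI)
     (auto simp: lookup_sum lookup_single when_def in_keys_iff sum.delta)

lemma eval_at_mult: "eval_at f (x * y) = eval_at f x * eval_at f y"
proof -
  have "x * y = (\<Sum>m\<in>Poly_Mapping.keys x. Poly_Mapping.single m (Poly_Mapping.lookup x m))
      * (\<Sum>n\<in>Poly_Mapping.keys y. Poly_Mapping.single n (Poly_Mapping.lookup y n))"
    using sum_of_monomials[of x] sum_of_monomials[of y] by simp
  also have "\<dots> = (\<Sum>m\<in>Poly_Mapping.keys x. \<Sum>n\<in>Poly_Mapping.keys y. Poly_Mapping.single (m + n) (Poly_Mapping.lookup x m * Poly_Mapping.lookup y n))"
    by (simp add: sum_product mult_single)
  finally have "eval_at f (x * y) = (\<Sum>m\<in>Poly_Mapping.keys x. \<Sum>n\<in>Poly_Mapping.keys y.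
      scalar (Poly_Mapping.lookup x m * Poly_Mapping.lookup y n) * monom_eval f (m + n))"
    by (simp add: eval_at_sum eval_at_single)
  also have "\<dots> = eval_at f x * eval_at f y"
    by (simp add: eval_at_def sum_product scalar_mult monom_eval_add mult_ac)
  finally show ?thesis .
qed

lemma eval_at_scalar: "eval_at f (scalar q) = scalar q"
  by (simp add: scalar_def eval_at_single monom_eval_def)

lemma eval_at_CP: "eval_at f (CP (Suc n)) = f n"
  by (simp add: CP_def eval_at_single monom_eval_def)

lemma eval_at_hom: "comm_ring_hom (eval_at f)"
  by unfold_locales (use eval_at_scalar[of f 1] in \<open>auto simp: eval_at_add eval_at_mult\<close>)

section \<open>Hazewinkel generators\<close>

definition prime_power :: "nat \<Rightarrow> nat \<Rightarrow> bool" where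
  "prime_power p n \<longleftrightarrow> (\<exists>i>0. n = p ^ i)"

text \<open>The coefficient with which the generator \<open>y\<^sub>n\<close> enters the \<open>n\<close>-th coefficient of the logarithm.\<close>

definition log_lead :: "nat \<Rightarrow> nat \<Rightarrow> rat" where
  "log_lead p n = (if prime_power p n then 1 / of_nat p else 1)"

text \<open>Generators \<open>y\<^sub>n\<close> with \<open>n\<close> a power of \<open>p\<close> play the role of the \<open>v\<^sub>i\<close> in the functional
  equation, the others that of the coefficients of the inhomogeneous term.  Later the family \<open>y\<close> has
  \<open>y\<^sub>1 = 1\<close>, which makes the leading term \<open>u\<close>; note that \<open>p^0 = 1\<close> does not count as a power.\<close>

definition base_series :: "nat \<Rightarrow> (nat \<Rightarrow> cobordism_rat) \<Rightarrow> cobordism_rat fps" where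
  "base_series p y = Abs_fps (\<lambda>n. if prime_power p n then 0 else y n)"

definition proper_powers :: "nat \<Rightarrow> nat \<Rightarrow> nat set" where
  "proper_powers p n = {i. i \<in> {1..n} \<and> p ^ i dvd n \<and> p ^ i < n \<and> 1 < p}"

lemma proper_powersD:
  assumes "i \<in> proper_powers p n"
  shows "p ^ i < n" "n div p ^ i < n"
  using assms power_dvd_imp_less(1)[of p n i] by (auto simp: proper_powers_def)

lemma sum_prime_powers:
  fixes g :: "nat \<Rightarrow> 'a::comm_monoid_add"
  assumes "p > 1" "n > 0"
  shows "(\<Sum>i | i \<in> {1..n} \<and> p ^ i dvd n. g i)
    = (\<Sum>i\<in>proper_powers p n. g i) + (\<Sum>i | i > 0 \<and> n = p ^ i. g i)"
proof -
  have less: "i < p ^ i" for i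
    using power_dvd_imp_less(3)[OF assms(1), of "p ^ i" i] assms(1) by (cases "i = 0") auto
  have fin: "finite {i. i > 0 \<and> n = p ^ i}"
    by (rule finite_subset[of _ "{..n}"]) (use less in \<open>auto intro: less_imp_le\<close>)
  have "{i. i \<in> {1..n} \<and> p ^ i dvd n} = proper_powers p n \<union> {i. i > 0 \<and> n = p ^ i}"
    using assms less by (auto simp: proper_powers_def dest: dvd_imp_le intro: less_imp_le)
  moreover have "proper_powers p n \<inter> {i. i > 0 \<and> n = p ^ i} = {}" "finite (proper_powers p n)"
    by (auto simp: proper_powers_def)
  ultimately show ?thesis using fin by (simp add: sum.union_disjoint)
qed

text \<open>The generators have to satisfy a recursion that involves \<open>\<sigma>\<close>, while \<open>\<sigma>\<close> is determined by its values
  on the generators.  The recursion therefore computes, along with \<open>y\<^sub>n\<close>, the values that all the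
  powers \<open>\<sigma>\<^sup>r\<close> are going to take on the \<open>n\<close>-th coefficient of the logarithm.\<close>

function hazewinkel_table :: "nat \<Rightarrow> nat \<Rightarrow> cobordism_rat \<times> (nat \<Rightarrow> cobordism_rat)" where
  "hazewinkel_table p n =
    (let y = scalar (1 / log_lead p n) * (logU $ n - scalar (1 / of_nat p) *
           (\<Sum>i\<in>proper_powers p n. fst (hazewinkel_table p (p ^ i)) * snd (hazewinkel_table p (n div p ^ i)) i))
     in (y, \<lambda>r. scalar (log_lead p n) * y ^ (p ^ r) + scalar (1 / of_nat p) *
           (\<Sum>i\<in>proper_powers p n. fst (hazewinkel_table p (p ^ i)) ^ (p ^ r)
              * snd (hazewinkel_table p (n div p ^ i)) (r + i))))"
  by pat_completeness auto
termination
  by (relation "measure snd") (auto dest: proper_powersD)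

declare hazewinkel_table.simps [simp del]

text \<open>The entries \<open>y 0\<close> and \<open>y 1\<close> are conventions; the generators proper start with \<open>y 2\<close>.\<close>

locale hazewinkel = comm_ring_hom \<sigma> for \<sigma> :: "cobordism_rat \<Rightarrow> cobordism_rat" +
  fixes p :: nat and y :: "nat \<Rightarrow> cobordism_rat"
  assumes prime_p: "prime p" and \<sigma>_scalar: "\<sigma> (scalar q) = scalar q" and \<sigma>_y: "\<sigma> (y n) = y n ^ p"
    and y_0: "y 0 = 0" and y_1: "y 1 = 1"
    and log_eq: "functional_eq p (scalar (1 / of_nat p)) \<sigma> (\<lambda>i. y (p ^ i)) (base_series p y) logU"

text \<open>The equation for the \<open>n\<close>-th logarithm coefficient is linear in \<open>y\<^sub>n\<close> with invertible leading
  coefficient, so it defines \<open>y\<^sub>n\<close>.  With \<open>\<sigma>\<close> given by the column \<open>r = 1\<close> of the table, applying \<open>\<sigma>\<close>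
  to the equation for \<open>r = 0\<close> and comparing with the one for \<open>r = 1\<close> yields \<open>\<sigma> y\<^sub>n = y\<^sub>n^p\<close>.\<close>

theorem hazewinkel_generators:
  assumes p: "prime p"
  obtains \<sigma> y where "hazewinkel \<sigma> p y"
proof -
  have p1: "p > 1" using p by (rule prime_gt_1_nat)
  define y where "y n = fst (hazewinkel_table p n)" for n
  define M where "M r n = snd (hazewinkel_table p n) r" for r n
  let ?\<pi> = "scalar (1 / of_nat p)"
  let ?c = "\<lambda>n. scalar (log_lead p n)"
  have c_inv: "?c n * scalar (1 / log_lead p n) = 1" for n
    using p1 by (simp add: log_lead_def flip: scalar_mult)
  have y_eq: "y n = scalar (1 / log_lead p n) * (logU $ n - ?\<pi> * (\<Sum>i\<in>proper_powers p n. y (p ^ i) * M i (n div p ^ i)))"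
    for n
    unfolding y_def M_def by (subst hazewinkel_table.simps) (simp add: Let_def)
  have M_eq: "M r n = ?c n * y n ^ (p ^ r)
      + ?\<pi> * (\<Sum>i\<in>proper_powers p n. y (p ^ i) ^ (p ^ r) * M (r + i) (n div p ^ i))" for r n
    unfolding y_eq[of n] unfolding y_def M_def by (subst hazewinkel_table.simps) (simp add: Let_def)
  have log_eq: "logU $ n = ?c n * y n + ?\<pi> * (\<Sum>i\<in>proper_powers p n. y (p ^ i) * M i (n div p ^ i))"
    for n
    unfolding y_eq[of n] using c_inv[of n] by (simp flip: mult.assoc)
  have M0: "M 0 n = logU $ n" for n
    unfolding log_eq[of n] M_eq[of 0 n] by simp
  have pp: "proper_powers p n = {}" if "n \<le> 1" for n
  proof -
    have "\<not> p ^ i < n" for i using that p1 by (simp add: not_less le_trans[OF that])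
    then show ?thesis by (auto dest: proper_powersD)
  qed
  have npp: "log_lead p n = 1" if "n \<le> 1" for n
  proof -
    have "n \<noteq> p ^ i" if "i > 0" for i using one_less_power[OF p1 that] \<open>n \<le> 1\<close> by linarith
    then show ?thesis by (auto simp: log_lead_def prime_power_def)
  qed
  have y0: "y 0 = 0" and y1: "y 1 = 1"
    using log_eq[of 0] log_eq[of 1] by (simp_all add: pp npp)
  have M1: "M r n = of_nat n" if "n \<le> 1" for r n
  proof -
    consider "n = 0" | "n = 1" using \<open>n \<le> 1\<close> by linarith
    then show ?thesis
      unfolding M_eq[of r n] pp[OF that] npp[OF that]
      using y0 y1 p1 by cases (simp_all add: power_0_left)
  qed
  define \<sigma> where "\<sigma> = eval_at (\<lambda>i. scalar (of_nat (i + 2)) * M 1 (i + 2))"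
  interpret comm_ring_hom \<sigma> unfolding \<sigma>_def by (rule eval_at_hom)
  have \<sigma>_scalar: "\<sigma> (scalar q) = scalar q" for q
    by (simp add: \<sigma>_def eval_at_scalar)
  have \<sigma>_log: "\<sigma> (logU $ n) = M 1 n" for n
  proof (cases "n \<le> 1")
    case True
    then consider "n = 0" | "n = 1" by linarith
    then show ?thesis by cases (simp_all add: hom_zero hom_one M1)
  next
    case False
    then obtain k where k: "n = Suc (Suc k)" by (metis One_nat_def Suc_le_eq le_Suc_ex add_Suc not_less_eq_eq)
    have "logU $ n = scalar (1 / of_nat n) * CP (Suc k)" by (simp add: logU_def k)
    then have "\<sigma> (logU $ n) = scalar (1 / of_nat n) * \<sigma> (CP (Suc k))"
      by (simp only: hom_mult \<sigma>_scalar)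
    also have "\<sigma> (CP (Suc k)) = scalar (of_nat n) * M 1 n"
      by (simp add: \<sigma>_def eval_at_CP k)
    also have "scalar (1 / of_nat n) * (scalar (of_nat n) * M 1 n)
        = (of_nat n * scalar (1 / of_nat n)) * M 1 n"
      by (simp only: scalar_of_nat mult_ac)
    also have "\<dots> = M 1 n"
      using k by (subst scalar_inverse) simp_all
    finally show ?thesis .
  qed
  have \<sigma>_table: "\<sigma> (y n) = y n ^ p \<and> (\<forall>r. \<sigma> (M r n) = M (Suc r) n)" for n
  proof (induction n rule: less_induct)
    case (less n)
    have IH: "\<sigma> (y (p ^ i)) = y (p ^ i) ^ p" "\<sigma> (M r (n div p ^ i)) = M (Suc r) (n div p ^ i)"
      if "i \<in> proper_powers p n" for i r
      using less.IH proper_powersD[OF that] by auto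
    have "M 1 n = ?c n * \<sigma> (y n)
        + ?\<pi> * (\<Sum>i\<in>proper_powers p n. y (p ^ i) ^ p * M (Suc i) (n div p ^ i))"
      unfolding \<sigma>_log[symmetric] log_eq[of n]
      by (simp add: hom_add hom_mult hom_sum \<sigma>_scalar IH)
    then have "?c n * \<sigma> (y n) = ?c n * y n ^ p"
      unfolding M_eq[of 1 n] by auto
    moreover have "?c n \<noteq> 0"
      using c_inv[of n] by auto
    ultimately have 1: "\<sigma> (y n) = y n ^ p" by simp
    have "\<sigma> (M r n) = M (Suc r) n" for r
      unfolding M_eq[of r n] M_eq[of "Suc r" n]
      by (simp add: hom_add hom_mult hom_sum hom_power \<sigma>_scalar IH 1 power_mult[symmetric])
    with 1 show ?case by blast
  qed
  have \<sigma>_pow: "(\<sigma> ^^ i) (logU $ n) = M i n" for i n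
    by (induction i) (simp_all add: M0 \<sigma>_table)
  have "logU $ n = base_series p y $ n
      + ?\<pi> * (\<Sum>i | i \<in> {1..n} \<and> p ^ i dvd n. y (p ^ i) * (\<sigma> ^^ i) (logU $ (n div p ^ i)))" for n
  proof (cases "n = 0")
    case False
    then have n0: "n > 0" by simp
    have top: "(\<Sum>i | i > 0 \<and> n = p ^ i. y (p ^ i) * M i (n div p ^ i)) = (if prime_power p n then y n else 0)"
    proof (cases "prime_power p n")
      case True
      then obtain i where i: "i > 0" "n = p ^ i" by (auto simp: prime_power_def)
      then have single: "{j. j > 0 \<and> n = p ^ j} = {i}" using p1 by auto
      show ?thesis using True i p1 M1[of 1] unfolding single by simp
    next
      case False
      then have empty: "{j. j > 0 \<and> n = p ^ j} = {}" by (auto simp: prime_power_def)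
      show ?thesis using False unfolding empty by simp
    qed
    have "(\<Sum>i | i \<in> {1..n} \<and> p ^ i dvd n. y (p ^ i) * (\<sigma> ^^ i) (logU $ (n div p ^ i)))
      = (\<Sum>i\<in>proper_powers p n. y (p ^ i) * M i (n div p ^ i)) + (if prime_power p n then y n else 0)"
      unfolding \<sigma>_pow sum_prime_powers[OF p1 n0] top ..
    then show ?thesis
      by (subst log_eq) (simp add: base_series_def log_lead_def distrib_left)
  qed (simp add: base_series_def y0)
  then have "functional_eq p ?\<pi> \<sigma> (\<lambda>i. y (p ^ i)) (base_series p y) logU"
    unfolding functional_eq_def by blast
  then have "hazewinkel \<sigma> p y"
    using p \<sigma>_scalar \<sigma>_table y0 y1 by unfold_locales auto
  then show thesis by (rule that)
qed

section \<open>The local ring at a prime\<close>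

lemma Z_at_iff:
  "q \<in> Z_at p \<longleftrightarrow> (\<exists>a b. b \<noteq> 0 \<and> coprime b (int p) \<and> q = of_int a / of_int b)"
proof
  assume "q \<in> Z_at p"
  then have "coprime (snd (quotient_of q)) (int p)" by (simp add: Z_at_def)
  then show "\<exists>a b. b \<noteq> 0 \<and> coprime b (int p) \<and> q = of_int a / of_int b"
    using quotient_of_div[of q] quotient_of_denom_pos[of q]
    by (cases "quotient_of q") (metis less_irrefl snd_conv)
next
  assume "\<exists>a b. b \<noteq> 0 \<and> coprime b (int p) \<and> q = of_int a / of_int b"
  then obtain a b where ab: "b \<noteq> 0" "coprime b (int p)" "q = of_int a / of_int b" by blast
  obtain a' b' where q: "quotient_of q = (a', b')" by (cases "quotient_of q")
  have b': "b' > 0" "coprime a' b'" "q = of_int a' / of_int b'"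
    using quotient_of_denom_pos[OF q] quotient_of_coprime[OF q] quotient_of_div[OF q] by auto
  have "(of_int (a' * b) :: rat) = of_int (a * b')"
    using ab b' by (simp add: field_simps)
  then have "a' * b = a * b'" by (simp only: of_int_eq_iff)
  then have "b' dvd b * a'" by (simp add: mult.commute)
  then have "b' dvd b"
    using b'(2) by (simp add: coprime_commute coprime_dvd_mult_left_iff)
  then have "coprime b' (int p)" using coprime_divisors[OF _ dvd_refl ab(2)] by blast
  then show "q \<in> Z_at p" by (simp add: Z_at_def q)
qed

lemma Z_at_of_int: "of_int a \<in> Z_at p"
  unfolding Z_at_iff by (rule exI[of _ a], rule exI[of _ 1]) simp

lemma Z_at_inverse: "b \<noteq> 0 \<Longrightarrow> coprime b (int p) \<Longrightarrow> 1 / of_int b \<in> Z_at p"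
  unfolding Z_at_iff by (rule exI[of _ 1], rule exI[of _ b]) simp

text \<open>Both sides of the congruence \<open>\<sigma> a \<equiv> a^p\<close> are additive and multiplicative modulo \<open>p\<close>, so it is
  enough to check it on ring generators.\<close>

lemma frobenius_lift_hull:
  assumes "comm_ring_hom \<sigma>" and p: "prime p"
    and G: "\<And>g. g \<in> G \<Longrightarrow> \<sigma> g - g ^ p \<in> multiples (of_nat p) (is_subring hull G)"
  shows "frobenius_lift \<sigma> p (is_subring hull G)"
proof -
  interpret comm_ring_hom \<sigma> by fact
  let ?S = "is_subring hull G"
  let ?J = "multiples (of_nat p) ?S"
  have S: "is_subring ?S" by (rule is_subring_hull)
  have J: "is_submodule ?S ?J" by (rule multiples_submodule[OF S])
  have JS: "?J \<subseteq> ?S" by (rule multiples_subset[OF S subring_of_nat[OF S]])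
  define T where "T = {a \<in> ?S. \<sigma> a - a ^ p \<in> ?J}"
  have T_diff: "x - y \<in> T" if "x \<in> T" "y \<in> T" for x y
  proof -
    have "x - y \<in> ?S" using that subring_diff[OF S] by (auto simp: T_def)
    moreover have "(x - y + y) ^ p - ((x - y) ^ p + y ^ p) \<in> ?J"
      using that calculation by (intro freshman_cong[OF S p]) (auto simp: T_def)
    then have "x ^ p - ((x - y) ^ p + y ^ p) \<in> ?J" by (simp only: diff_add_cancel)
    then have "(\<sigma> x - x ^ p) - (\<sigma> y - y ^ p) + (x ^ p - ((x - y) ^ p + y ^ p)) \<in> ?J"
      using that by (intro submodule_add[OF J submodule_diff[OF J S]]) (auto simp: T_def)
    moreover have "\<sigma> (x - y) = \<sigma> x - \<sigma> y"
      using hom_add[of "x - y" y] by simp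
    then have "\<sigma> (x - y) - (x - y) ^ p
        = (\<sigma> x - x ^ p) - (\<sigma> y - y ^ p) + (x ^ p - ((x - y) ^ p + y ^ p))" by simp
    ultimately show ?thesis unfolding T_def by (simp only: mem_Collect_eq)
  qed
  have T_mult: "x * y \<in> T" if xy: "x \<in> T" "y \<in> T" for x y
  proof -
    have "\<sigma> y \<in> ?S"
      using subring_add[OF S, of "\<sigma> y - y ^ p" "y ^ p"] xy JS subring_power[OF S] by (auto simp: T_def)
    then have "\<sigma> x * \<sigma> y - x ^ p * y ^ p \<in> ?J"
      using xy by (intro ideal_mult_cong[OF S J] subring_power[OF S]) (auto simp: T_def)
    then show ?thesis
      using xy subring_mult[OF S] by (simp add: T_def hom_mult power_mult_distrib)
  qed
  have "is_subring T"
    using T_diff T_mult subring_one[OF S] submodule_zero[OF J]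
    by (auto simp: is_subring_def) (simp add: T_def hom_one)
  moreover have "G \<subseteq> T"
    using G hull_subset[of G is_subring] by (auto simp: T_def)
  ultimately have "?S \<subseteq> T" by (intro hull_minimal)
  then show ?thesis
    by unfold_locales (use p S in \<open>auto simp: T_def\<close>)
qed

text \<open>Fermat's little theorem: the identity is a lift of Frobenius on the subring generated by the empty set.\<close>

lemma int_power_prime_cong:
  fixes a :: int
  assumes "prime p"
  shows "int p dvd a - a ^ p"
proof -
  have "frobenius_lift (\<lambda>x::int. x) p (is_subring hull {})"
    by (rule frobenius_lift_hull) (unfold_locales, use assms in auto)
  then have "a - a ^ p \<in> multiples (of_nat p) (is_subring hull {})"
    using frobenius_lift.lift subring_of_int[OF is_subring_hull, of a] by fastforce
  then show ?thesis by (auto elim: multiplesE)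
qed

lemma Z_at_power_prime_cong:
  assumes p: "prime p" and q: "q \<in> Z_at p"
  shows "\<exists>c\<in>Z_at p. q - q ^ p = of_nat p * c"
proof -
  obtain a b where ab: "b \<noteq> 0" "coprime b (int p)" "q = of_int a / of_int b"
    using q by (auto simp: Z_at_iff)
  obtain c where c: "a - a ^ p = int p * c"
    using int_power_prime_cong[OF p] by (auto simp: dvd_def)
  obtain d where d: "b - b ^ p = int p * d"
    using int_power_prime_cong[OF p] by (auto simp: dvd_def)
  have "a * b ^ p - a ^ p * b = b * (a - a ^ p) - a * (b - b ^ p)" by (simp add: algebra_simps)
  also have "\<dots> = int p * (b * c - a * d)" unfolding c d by (simp add: algebra_simps)
  finally have "(of_int (a * b ^ p - a ^ p * b) :: rat) = of_int (int p * (b * c - a * d))" by simp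
  moreover have "q - q ^ p = of_int (a * b ^ p - a ^ p * b) / of_int (b ^ Suc p)"
    using ab(1) by (simp add: ab(3) power_divide diff_frac_eq)
  ultimately have "q - q ^ p = of_nat p * (of_int (b * c - a * d) / of_int (b ^ Suc p))"
    by simp
  moreover have "of_int (b * c - a * d) / of_int (b ^ Suc p) \<in> Z_at p"
    unfolding Z_at_iff using ab(1,2)
    by (intro exI[of _ "b * c - a * d"] exI[of _ "b ^ Suc p"]) auto
  ultimately show ?thesis by blast
qed

lemma prime_dvd_power_diff_self:
  assumes p: "prime p" and "(p - 1) dvd (n - 1)" "n > 0"
  shows "\<exists>c. int k ^ n - int k = int p * c"
proof -
  obtain m where m: "n = Suc ((p - 1) * m)" using assms by (metis Suc_pred' dvdE)
  have "int p dvd int k ^ Suc ((p - 1) * m) - int k" for m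
  proof (induction m)
    case (Suc m)
    have "p > 0" using p prime_gt_0_nat by blast
    then have "int k ^ Suc ((p - 1) * Suc m) - int k
      = (int k ^ Suc ((p - 1) * m) - int k) * int k ^ (p - 1) - (int k - int k ^ p)"
      by (cases p) (simp_all add: algebra_simps power_add)
    then show ?case
      using Suc int_power_prime_cong[OF p, of "int k"] by (metis dvd_diff dvd_mult2)
  qed simp
  then show ?thesis unfolding m by (auto simp: dvd_def)
qed

text \<open>With \<open>q\<close> a power of \<open>p\<close> dividing \<open>n\<close>, all the binomial coefficients \<open>n choose i\<close> with \<open>0 < i < q\<close>
  vanish modulo \<open>p\<close>, so by Pascal's rule \<open>(n - 1) choose i\<close> only changes its sign with \<open>i\<close>.\<close>

lemma prime_not_dvd_choose:
  assumes p: "prime p" and n: "p ^ b dvd n" "n > 0" and i: "i < p ^ b"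
  shows "\<not> p dvd (n - 1 choose i)"
  using i
proof (induction i)
  case 0
  then show ?case using p by (simp add: not_prime_1 prime_nat_iff)
next
  case (Suc i)
  have "p dvd (n choose Suc i)"
  proof (rule ccontr)
    assume "\<not> p dvd (n choose Suc i)"
    then have "coprime (p ^ b) (n choose Suc i)"
      using p by (simp add: prime_imp_coprime)
    moreover have "Suc i * (n choose Suc i) = n * (n - 1 choose i)"
      using binomial_absorption[of i n] n by simp
    then have "p ^ b dvd Suc i * (n choose Suc i)" using n by simp
    ultimately have "p ^ b dvd Suc i" by (metis coprime_dvd_mult_left_iff)
    then show False using Suc.prems by (auto dest: dvd_imp_le)
  qed
  moreover have "n choose Suc i = (n - 1 choose i) + (n - 1 choose Suc i)"
    using n by (cases n) simp_all
  ultimately show ?case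
    using Suc by (metis Suc_lessD dvd_add_left_iff)
qed

section \<open>Formal group laws in a homogeneous variable\<close>

text \<open>The substitution \<open>x = u\<close>, \<open>y = s u\<close> turns a series in \<open>x, y\<close> into a series in \<open>u\<close> whose \<open>n\<close>-th
  coefficient is the polynomial in \<open>s\<close> collecting the terms of total degree \<open>n\<close>.  The formal group
  law thereby becomes an ordinary composition of power series with zero constant term.\<close>

definition homog_y :: "'a::comm_ring_1 fps \<Rightarrow> 'a fps fps" where
  "homog_y f = Abs_fps (\<lambda>n. fps_const (f $ n) * fps_X ^ n)"

definition homog_sum :: "'a::comm_ring_1 fps \<Rightarrow> 'a fps fps" where
  "homog_sum f = map_fps fps_const f + homog_y f"

definition homog_fgl :: "'a::comm_ring_1 fps \<Rightarrow> 'a fps fps" where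
  "homog_fgl f = map_fps fps_const (fps_rev f) oo homog_sum f"

lemma fps_const_hom: "comm_ring_hom (fps_const :: 'a::comm_ring_1 \<Rightarrow> 'a fps)"
  by unfold_locales (simp_all add: fps_const_add fps_const_mult)

lemma homog_y_hom: "comm_ring_hom (homog_y :: 'a::comm_ring_1 fps \<Rightarrow> 'a fps fps)"
proof
  fix f g :: "'a fps"
  show "homog_y 1 = (1 :: 'a fps fps)"
    by (intro fps_ext) (auto simp: homog_y_def fps_one_nth)
  show "homog_y (f + g) = homog_y f + homog_y g"
    by (intro fps_ext) (simp add: homog_y_def distrib_right flip: fps_const_add)
  show "homog_y (f * g) = homog_y f * homog_y g"
  proof (rule fps_ext)
    fix n
    have "fps_const ((f * g) $ n) * fps_X ^ n
        = (\<Sum>i=0..n. fps_const (f $ i) * fps_const (g $ (n - i))) * fps_X ^ n"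
      by (simp add: fps_mult_nth comm_ring_hom.hom_sum[OF fps_const_hom])
    also have "\<dots> = (\<Sum>i=0..n. (fps_const (f $ i) * fps_X ^ i) * (fps_const (g $ (n - i)) * fps_X ^ (n - i)))"
      unfolding sum_distrib_right
    proof (rule sum.cong)
      fix i assume "i \<in> {0..n}"
      then have "fps_X ^ n = fps_X ^ i * (fps_X :: 'a fps) ^ (n - i)" by (simp flip: power_add)
      then show "fps_const (f $ i) * fps_const (g $ (n - i)) * fps_X ^ n
        = (fps_const (f $ i) * fps_X ^ i) * (fps_const (g $ (n - i)) * fps_X ^ (n - i))"
        by (simp only: mult_ac)
    qed simp
    finally show "homog_y (f * g) $ n = (homog_y f * homog_y g) $ n"
      by (simp add: homog_y_def fps_mult_nth)
  qed
qed

lemma in_xy_eq: "in_x = fps_const" "in_y = map_fps fps_const"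
  by (simp_all add: fun_eq_iff in_x_def in_y_def map_fps_def)

lemma homog_sum_power_nth:
  fixes f :: "'a::comm_ring_1 fps"
  assumes "j \<le> n"
  shows "(homog_sum f ^ k) $ n $ j = ((in_x f + in_y f) ^ k) $ j $ (n - j)"
proof -
  interpret C: comm_ring_hom "fps_const :: 'a fps \<Rightarrow> _" by (rule fps_const_hom)
  interpret M: comm_ring_hom "map_fps fps_const :: 'a fps \<Rightarrow> _"
    by (rule comm_ring_hom.hom_map_fps[OF fps_const_hom])
  interpret Y: comm_ring_hom "homog_y :: 'a fps \<Rightarrow> _" by (rule homog_y_hom)
  have of_nat_nth: "(of_nat c * g) $ a $ b = of_nat c * g $ a $ b" for c a b and g :: "'a fps fps"
    by (simp flip: fps_of_nat)
  have 1: "(map_fps fps_const g * homog_y h) $ n $ j = g $ (n - j) * h $ j" for g h :: "'a fps"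
  proof -
    have "(map_fps fps_const g * homog_y h) $ n
        = (\<Sum>i=0..n. fps_const (g $ i * h $ (n - i)) * fps_X ^ (n - i))"
      by (simp add: fps_mult_nth homog_y_def flip: mult.assoc fps_const_mult)
    then have "(map_fps fps_const g * homog_y h) $ n $ j
        = (\<Sum>i=0..n. g $ i * h $ (n - i) * (if j = n - i then 1 else 0))"
      by (simp add: fps_sum_nth)
    also have "\<dots> = (\<Sum>i=0..n. if i = n - j then g $ i * h $ (n - i) else 0)"
      using assms by (intro sum.cong) auto
    finally show ?thesis using assms by (simp add: sum.delta)
  qed
  have 2: "(fps_const g * map_fps fps_const h) $ j $ (n - j) = g $ (n - j) * h $ j" for g h :: "'a fps"
    by simp
  show ?thesis
    unfolding homog_sum_def in_xy_eq binomial_ring fps_sum_nth mult.assoc of_nat_nth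
      M.hom_power[symmetric] Y.hom_power[symmetric] C.hom_power[symmetric] 1 2 ..
qed

lemma homog_fgl_nth:
  assumes "j \<le> n"
  shows "homog_fgl logU $ n $ j = fglU (n - j) j"
proof -
  have "homog_fgl logU $ n $ j = (\<Sum>k=0..n. expU $ k * (homog_sum logU ^ k) $ n $ j)"
    by (simp add: homog_fgl_def expU_def fps_compose_nth fps_sum_nth)
  also have "\<dots> = fglU (n - j) j"
    using assms by (simp add: fglU_def homog_sum_power_nth atMost_atLeast0)
  finally show ?thesis .
qed

lemma homog_fgl_0: "f $ 0 = 0 \<Longrightarrow> homog_fgl f $ 0 = 0"
  by (simp add: homog_fgl_def fps_rev_def)

lemma compose_homog_fgl:
  fixes f :: "'a::idom fps"
  assumes f: "f $ 0 = 0" "f $ 1 = 1"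
  shows "map_fps fps_const f oo homog_fgl f = homog_sum f"
proof -
  have "homog_sum f $ 0 = 0" using f by (simp add: homog_sum_def homog_y_def)
  moreover have "map_fps fps_const (fps_rev f) $ 0 = 0" by (simp add: fps_rev_def)
  ultimately have "map_fps fps_const f oo homog_fgl f
      = (map_fps fps_const f oo map_fps fps_const (fps_rev f)) oo homog_sum f"
    unfolding homog_fgl_def by (rule fps_compose_assoc)
  also have "map_fps fps_const f oo map_fps fps_const (fps_rev f) = fps_X"
    unfolding comm_ring_hom.map_fps_compose[OF fps_const_hom, symmetric]
    using f by (simp add: fps_rev_right fps_eq_iff)
  finally show ?thesis using f by (simp add: homog_sum_def homog_y_def)
qed

text \<open>In the homogeneous variable \<open>s\<close> the lift of Frobenius sends \<open>s\<close> to \<open>s\<^sup>p\<close>, so \<open>f(u) + f(s u)\<close>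
  satisfies the same functional equation as \<open>f\<close>.\<close>

lemma functional_eq_homog:
  fixes \<sigma> :: "'a::idom \<Rightarrow> 'a"
  assumes \<sigma>: "comm_ring_hom \<sigma>" and p: "p > 1" and f: "functional_eq p \<pi> \<sigma> v b f"
  shows "functional_eq p (fps_const \<pi>) (frob_fps p \<sigma>) (\<lambda>i. fps_const (v i))
           (map_fps fps_const b) (map_fps fps_const f)"
    and "functional_eq p (fps_const \<pi>) (frob_fps p \<sigma>) (\<lambda>i. fps_const (v i))
           (homog_y b) (homog_y f)"
proof -
  interpret C: comm_ring_hom "fps_const :: 'a \<Rightarrow> _" by (rule fps_const_hom)
  have frob_monom: "(frob_fps p \<sigma> ^^ i) (fps_const a * fps_X ^ k) = fps_const ((\<sigma> ^^ i) a) * fps_X ^ (k * p ^ i)"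
    for i a k
  proof (rule fps_ext)
    fix n
    have "p ^ i > 0" using p by simp
    then show "(frob_fps p \<sigma> ^^ i) (fps_const a * fps_X ^ k) $ n = (fps_const ((\<sigma> ^^ i) a) * fps_X ^ (k * p ^ i)) $ n"
      using p \<sigma> comm_ring_hom.hom_zero[OF comm_ring_hom_funpow[OF \<sigma>]]
      by (auto simp: frob_fps_funpow_nth)
  qed
  have frob_const: "(frob_fps p \<sigma> ^^ i) (fps_const a) = fps_const ((\<sigma> ^^ i) a)" for i a
    using frob_monom[of i a 0] by simp
  have expand: "fps_const (f $ n) = fps_const (b $ n) + fps_const \<pi> * (\<Sum>i | i \<in> {1..n} \<and> p ^ i dvd n.
      fps_const (v i) * fps_const ((\<sigma> ^^ i) (f $ (n div p ^ i))))" for n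
    by (subst functional_eqD[OF f]) (simp only: C.hom_add C.hom_mult C.hom_sum)
  show "functional_eq p (fps_const \<pi>) (frob_fps p \<sigma>) (\<lambda>i. fps_const (v i))
           (map_fps fps_const b) (map_fps fps_const f)"
    unfolding functional_eq_def map_fps_nth frob_const using expand by blast
  have "fps_const (f $ n) * fps_X ^ n = fps_const (b $ n) * fps_X ^ n
      + fps_const \<pi> * (\<Sum>i | i \<in> {1..n} \<and> p ^ i dvd n.
          fps_const (v i) * (frob_fps p \<sigma> ^^ i) (fps_const (f $ (n div p ^ i)) * fps_X ^ (n div p ^ i)))" for n
  proof -
    have "(\<Sum>i | i \<in> {1..n} \<and> p ^ i dvd n.
          fps_const (v i) * (frob_fps p \<sigma> ^^ i) (fps_const (f $ (n div p ^ i)) * fps_X ^ (n div p ^ i)))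
        = (\<Sum>i | i \<in> {1..n} \<and> p ^ i dvd n. fps_const (v i) * fps_const ((\<sigma> ^^ i) (f $ (n div p ^ i)))) * fps_X ^ n"
      unfolding sum_distrib_right
      by (intro sum.cong) (simp_all only: frob_monom mem_Collect_eq dvd_div_mult_self mult.assoc)
    then show ?thesis by (subst expand) (simp only: distrib_right mult.assoc)
  qed
  then show "functional_eq p (fps_const \<pi>) (frob_fps p \<sigma>) (\<lambda>i. fps_const (v i)) (homog_y b) (homog_y f)"
    unfolding functional_eq_def homog_y_def fps_nth_Abs_fps by blast
qed

text \<open>To first order: changing \<open>f\<close> and \<open>f \<circ> E\<close> from degree \<open>n\<close> on changes the \<open>n\<close>-th coefficient of \<open>E\<close> by
  the change of \<open>f \<circ> E\<close> minus the change of \<open>f\<close> evaluated at the linear term of \<open>E\<close>.\<close>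

lemma compose_perturb:
  fixes f f' E E' :: "'a::comm_ring_1 fps"
  assumes E: "E $ 0 = 0" "E' $ 0 = 0" and f: "f $ 1 = 1" "f' $ 1 = 1"
    and eq: "\<And>k. k < n \<Longrightarrow> f $ k = f' $ k" "\<And>k. k < n \<Longrightarrow> (f oo E) $ k = (f' oo E') $ k"
    and n: "n > 1"
  shows "E $ n = E' $ n + ((f oo E) $ n - (f' oo E') $ n) - (f $ n - f' $ n) * (E' $ 1) ^ n"
proof -
  have below: "E $ k = E' $ k" if "k < n" for k
    using that
  proof (induction k rule: less_induct)
    case (less k)
    have "(f oo E') $ k = (f' oo E') $ k"
      using less.prems eq(1) by (simp add: fps_compose_nth)
    then show ?case
      using compose_nth_cong[of E E' k f] less eq(2)[of k] E f by (cases "k = 0") auto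
  qed
  have "(f oo E') $ n = (\<Sum>k=0..<n. f $ k * (E' ^ k) $ n) + f $ n * (E' ^ n) $ n"
    unfolding fps_compose_nth atLeastLessThanSuc_atLeastAtMost[symmetric] by simp
  moreover have "(f' oo E') $ n = (\<Sum>k=0..<n. f $ k * (E' ^ k) $ n) + f' $ n * (E' ^ n) $ n"
    unfolding fps_compose_nth atLeastLessThanSuc_atLeastAtMost[symmetric] by (simp add: eq(1))
  moreover have "(E' ^ n) $ n = (E' $ 1) ^ n"
    by (rule startsby_zero_power_nth_same[OF E(2)])
  moreover have "(f oo E) $ n - E $ n = (f oo E') $ n - E' $ n"
    using compose_nth_cong[of E E' n f] E n f below by simp
  ultimately show ?thesis by (simp add: algebra_simps)
qed

section \<open>Families of logarithms and truncation\<close>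

context hazewinkel
begin

lemma p_gt_1: "p > 1"
  using prime_p by (rule prime_gt_1_nat)

definition coord_ring :: "nat set \<Rightarrow> cobordism_rat set" where
  "coord_ring K = is_subring hull (scalar ` Z_at p \<union> y ` K)"

lemma coord_ring_subring: "is_subring (coord_ring K)"
  unfolding coord_ring_def by (rule is_subring_hull)

lemma scalar_in_coord_ring: "q \<in> Z_at p \<Longrightarrow> scalar q \<in> coord_ring K"
  unfolding coord_ring_def by (rule hull_inc) auto

lemma y_in_coord_ring: "k \<in> K \<Longrightarrow> y k \<in> coord_ring K"
  unfolding coord_ring_def by (rule hull_inc) auto

lemma coord_ring_lift: "frobenius_lift \<sigma> p (coord_ring K)"
  unfolding coord_ring_def
proof (rule frobenius_lift_hull[OF comm_ring_hom_axioms prime_p])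
  let ?S = "is_subring hull (scalar ` Z_at p \<union> y ` K)"
  fix g assume "g \<in> scalar ` Z_at p \<union> y ` K"
  then consider q where "q \<in> Z_at p" "g = scalar q" | k where "g = y k" by auto
  then show "\<sigma> g - g ^ p \<in> multiples (of_nat p) ?S"
  proof cases
    case 1
    obtain c where c: "c \<in> Z_at p" "q - q ^ p = of_nat p * c"
      using Z_at_power_prime_cong[OF prime_p 1(1)] by blast
    have "\<sigma> g - g ^ p = scalar (q - q ^ p)"
      using scalar_add[of "q - q ^ p" "q ^ p"] unfolding 1 \<sigma>_scalar scalar_power by simp
    then have "\<sigma> g - g ^ p = of_nat p * scalar c"
      by (simp add: c scalar_mult scalar_of_nat)
    then show ?thesis
      using scalar_in_coord_ring[OF c(1), of K] unfolding coord_ring_def by (intro multiplesI)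
  next
    case 2
    then show ?thesis
      by (simp add: \<sigma>_y submodule_zero[OF multiples_submodule[OF is_subring_hull]])
  qed
qed

text \<open>The logarithm belonging to an arbitrary family \<open>z\<close> in place of \<open>y\<close>.\<close>

definition log_series :: "(nat \<Rightarrow> cobordism_rat) \<Rightarrow> cobordism_rat fps \<Rightarrow> bool" where
  "log_series z f \<longleftrightarrow> z 0 = 0 \<and> z 1 = 1 \<and>
     functional_eq p (scalar (1 / of_nat p)) \<sigma> (\<lambda>i. z (p ^ i)) (base_series p z) f"

lemma not_prime_power_le_1: "n \<le> 1 \<Longrightarrow> \<not> prime_power p n"
proof -
  assume "n \<le> 1"
  have "n \<noteq> p ^ i" if "i > 0" for i using one_less_power[OF p_gt_1 that] \<open>n \<le> 1\<close> by linarith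
  then show ?thesis by (auto simp: prime_power_def)
qed

lemma base_series_nth_01:
  "z 0 = 0 \<Longrightarrow> base_series p z $ 0 = 0" "z 1 = 1 \<Longrightarrow> base_series p z $ 1 = 1"
  using not_prime_power_le_1[of 0] not_prime_power_le_1[of 1] by (simp_all add: base_series_def)

lemma log_series_nth_01:
  assumes "log_series z f"
  shows "f $ 0 = 0" "f $ 1 = 1"
  using assms functional_eq_nth_0 functional_eq_nth_1[OF _ p_gt_1] base_series_nth_01[of z]
  unfolding log_series_def by metis+

lemma log_series_nth:
  assumes f: "log_series z f" and n: "n > 0"
  shows "f $ n = scalar (log_lead p n) * z n + scalar (1 / of_nat p) *
    (\<Sum>i\<in>proper_powers p n. z (p ^ i) * (\<sigma> ^^ i) (f $ (n div p ^ i)))"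
proof -
  have \<sigma>1: "(\<sigma> ^^ i) 1 = 1" for i
    by (rule comm_ring_hom.hom_one[OF comm_ring_hom_funpow[OF comm_ring_hom_axioms]])
  have top: "(\<Sum>i | i > 0 \<and> n = p ^ i. z (p ^ i) * (\<sigma> ^^ i) (f $ (n div p ^ i)))
      = (if prime_power p n then z n else 0)"
  proof (cases "prime_power p n")
    case True
    then obtain i where i: "i > 0" "n = p ^ i" by (auto simp: prime_power_def)
    then have single: "{j. j > 0 \<and> n = p ^ j} = {i}" using p_gt_1 by auto
    show ?thesis
      using True i p_gt_1 log_series_nth_01(2)[OF f] unfolding single by (simp add: \<sigma>1)
  next
    case False
    then have empty: "{j. j > 0 \<and> n = p ^ j} = {}" by (auto simp: prime_power_def)
    show ?thesis using False unfolding empty by simp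
  qed
  have "f $ n = base_series p z $ n + scalar (1 / of_nat p) *
      (\<Sum>i | i \<in> {1..n} \<and> p ^ i dvd n. z (p ^ i) * (\<sigma> ^^ i) (f $ (n div p ^ i)))"
    using f unfolding log_series_def by (intro functional_eqD) blast
  then show ?thesis
    unfolding sum_prime_powers[OF p_gt_1 n] top
    by (simp add: base_series_def log_lead_def distrib_left)
qed

lemma log_series_logU: "log_series y logU"
  using log_eq y_0 y_1 by (simp add: log_series_def)

lemma base_series_in: "(\<And>k. z k \<in> S) \<Longrightarrow> is_subring S \<Longrightarrow> base_series p z \<in> coeffs_in S"
  by (auto simp: base_series_def coeffs_in_def subring_zero)

lemma log_series_homog_fgl_integral:
  assumes f: "log_series z f" and S: "frobenius_lift \<sigma> p S" and z: "\<And>k. z k \<in> S"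
  shows "homog_fgl f $ n $ j \<in> S"
proof -
  interpret S: frobenius_lift \<sigma> p S by fact
  let ?b = "base_series p z"
  have b: "?b \<in> coeffs_in S" by (rule base_series_in[OF z S.subring])
  have const_in: "fps_const a \<in> coeffs_in S" if "a \<in> S" for a
    using that subring_zero[OF S.subring] by (simp add: coeffs_in_def)
  have monom_in: "fps_const a * fps_X ^ k \<in> coeffs_in S" if "a \<in> S" for a k
    using that subring_zero[OF S.subring] by (auto simp: coeffs_in_def)
  have feq: "functional_eq p (scalar (1 / of_nat p)) \<sigma> (\<lambda>i. z (p ^ i)) ?b f"
    using f by (simp add: log_series_def)
  have z01: "z 0 = 0" "z 1 = 1" using f by (simp_all add: log_series_def)
  note f01 = log_series_nth_01[OF f]
  note homog = functional_eq_homog[OF comm_ring_hom_axioms p_gt_1 feq]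
  have "homog_fgl f \<in> coeffs_in (coeffs_in S)"
  proof (rule functional_equation_lemma(1)[OF frobenius_lift_fps[OF S], where b' = "homog_sum ?b"])
    show "of_nat p * fps_const (scalar (1 / of_nat p)) = (1 :: cobordism_rat fps)"
      using scalar_inverse[of p] p_gt_1 by (simp flip: fps_of_nat)
    show "map_fps fps_const ?b \<in> coeffs_in (coeffs_in S)"
      by (rule coeffs_inI) (simp add: const_in coeffs_inD[OF b])
    show "homog_sum ?b \<in> coeffs_in (coeffs_in S)"
      by (rule coeffs_inI)
         (auto simp: homog_sum_def homog_y_def
           intro!: subring_add[OF coeffs_in_subring[OF S.subring]] const_in monom_in coeffs_inD[OF b])
    show "map_fps fps_const ?b $ 0 = 0" "map_fps fps_const ?b $ 1 = 1" "homog_sum ?b $ 0 = 0"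
      using base_series_nth_01[of z] z01 by (simp_all add: homog_sum_def homog_y_def)
    show "functional_eq p (fps_const (scalar (1 / of_nat p))) (frob_fps p \<sigma>) (\<lambda>i. fps_const (z (p ^ i)))
        (homog_sum ?b) (homog_sum f)"
      unfolding homog_sum_def
      by (rule functional_eq_add[OF frob_fps_hom[OF comm_ring_hom_axioms] homog]) (use p_gt_1 in simp)
    show "map_fps fps_const f oo homog_fgl f = homog_sum f"
      by (rule compose_homog_fgl[OF f01])
  qed (use homog const_in z homog_fgl_0[OF f01(1)] in auto)
  then show ?thesis by (intro coeffs_inD)
qed

text \<open>Setting the generators from \<open>N\<close> on to zero leaves the logarithm unchanged below degree \<open>N\<close> and
  isolates the contribution of \<open>y\<^sub>N\<close> in degree \<open>N\<close>.\<close>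

definition truncated :: "nat \<Rightarrow> nat \<Rightarrow> cobordism_rat" where
  "truncated N k = (if k < N then y k else 0)"

definition truncated_log :: "nat \<Rightarrow> cobordism_rat fps" where
  "truncated_log N = Abs_fps (functional_eq_coeff p (scalar (1 / of_nat p)) \<sigma>
     (\<lambda>i. truncated N (p ^ i)) (base_series p (truncated N)))"

lemma log_series_truncated: "N > 1 \<Longrightarrow> log_series (truncated N) (truncated_log N)"
  unfolding log_series_def truncated_log_def using y_0 y_1
  by (auto intro: functional_eq_solution[OF p_gt_1] simp: truncated_def)

lemma truncated_log_below:
  assumes N: "N > 1" and k: "k < N"
  shows "truncated_log N $ k = logU $ k"
  using k
proof (induction k rule: less_induct)
  case (less k)
  show ?case
  proof (cases "k = 0")
    case True
    then show ?thesis using log_series_nth_01(1)[OF log_series_truncated[OF N]] by simp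
  next
    case False
    have "(\<Sum>i\<in>proper_powers p k. truncated N (p ^ i) * (\<sigma> ^^ i) (truncated_log N $ (k div p ^ i)))
        = (\<Sum>i\<in>proper_powers p k. y (p ^ i) * (\<sigma> ^^ i) (logU $ (k div p ^ i)))"
      using less by (intro sum.cong) (auto simp: truncated_def dest: proper_powersD)
    then show ?thesis
      using False less.prems
      by (simp add: log_series_nth[OF log_series_truncated[OF N]] log_series_nth[OF log_series_logU] truncated_def)
  qed
qed

lemma truncated_log_at:
  assumes N: "N > 1"
  shows "logU $ N - truncated_log N $ N = scalar (log_lead p N) * y N"
proof -
  have "(\<Sum>i\<in>proper_powers p N. truncated N (p ^ i) * (\<sigma> ^^ i) (truncated_log N $ (N div p ^ i)))
      = (\<Sum>i\<in>proper_powers p N. y (p ^ i) * (\<sigma> ^^ i) (logU $ (N div p ^ i)))"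
    using N proper_powersD[of _ p N] by (intro sum.cong) (simp_all add: truncated_def truncated_log_below)
  then show ?thesis
    using N log_series_nth[OF log_series_truncated[OF N], of N] log_series_nth[OF log_series_logU, of N]
    by (simp add: truncated_def)
qed

section \<open>The coefficient ring of the formal group law\<close>

text \<open>The group law of the truncated logarithm has coefficients in the lower generators.  By the first
  order perturbation formula the true one differs from it in degree \<open>N\<close> by \<open>c y\<^sub>N\<close> times
  \<open>1 + s^N - (1 + s)^N\<close>, with \<open>c\<close> the leading coefficient of the logarithm.\<close>

lemma fglU_top_generator:
  assumes N: "N > 1" and j: "0 < j" "j < N"
  shows "fglU (N - j) j + scalar (log_lead p N) * of_nat (N choose j) * y N \<in> coord_ring {..<N}"
proof -
  let ?f = "truncated_log N"
  let ?e = "scalar (log_lead p N) * y N"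
  note f01 = log_series_nth_01[OF log_series_truncated[OF N]]
  have logU01: "logU $ 0 = 0" "logU $ 1 = 1" by simp_all
  have below: "homog_sum logU $ k = homog_sum ?f $ k" if "k < N" for k
    using that by (simp add: homog_sum_def homog_y_def truncated_log_below[OF N])
  have E1: "homog_fgl ?f $ 1 = 1 + fps_X"
    using compose_nth_linear[of "homog_fgl ?f" 1 "map_fps fps_const ?f"] f01
    by (simp add: compose_homog_fgl homog_fgl_0 homog_sum_def homog_y_def)
  have e: "logU $ N = ?f $ N + ?e" using truncated_log_at[OF N] by (simp add: algebra_simps)
  have "homog_fgl logU $ N = homog_fgl ?f $ N
      + ((map_fps fps_const logU oo homog_fgl logU) $ N - (map_fps fps_const ?f oo homog_fgl ?f) $ N)
      - (map_fps fps_const logU $ N - map_fps fps_const ?f $ N) * (homog_fgl ?f $ 1) ^ N"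
  proof (rule compose_perturb[OF _ _ _ _ _ _ N])
    show "(map_fps fps_const logU oo homog_fgl logU) $ k = (map_fps fps_const ?f oo homog_fgl ?f) $ k"
      if "k < N" for k
      using below[OF that] by (simp only: compose_homog_fgl[OF logU01] compose_homog_fgl[OF f01])
  qed (use f01 logU01 truncated_log_below[OF N] in \<open>simp_all add: homog_fgl_0\<close>)
  also have "map_fps fps_const logU $ N - map_fps fps_const ?f $ N = fps_const ?e"
    unfolding map_fps_nth e by (simp flip: fps_const_add)
  also have "(map_fps fps_const logU oo homog_fgl logU) $ N - (map_fps fps_const ?f oo homog_fgl ?f) $ N
      = fps_const ?e * (1 + fps_X ^ N)"
    unfolding compose_homog_fgl[OF logU01] compose_homog_fgl[OF f01] homog_sum_def homog_y_def
      fps_add_nth map_fps_nth fps_nth_Abs_fps e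
    by (simp add: algebra_simps flip: fps_const_add)
  finally have "homog_fgl logU $ N $ j = homog_fgl ?f $ N $ j
      + (fps_const ?e * (1 + fps_X ^ N)) $ j - (fps_const ?e * (1 + fps_X) ^ N) $ j"
    unfolding E1 by simp
  moreover have "((1 + fps_X) ^ N :: cobordism_rat fps) $ j = of_nat (N choose j)"
    using j by (simp add: add.commute[of 1] binomial_ring fps_sum_nth if_distrib sum.delta flip: fps_of_nat cong: if_cong)
  ultimately have "fglU (N - j) j + scalar (log_lead p N) * of_nat (N choose j) * y N = homog_fgl ?f $ N $ j"
    using j by (simp add: homog_fgl_nth mult_ac)
  also have "\<dots> \<in> coord_ring {..<N}"
    by (rule log_series_homog_fgl_integral[OF log_series_truncated[OF N] coord_ring_lift])
       (auto simp: truncated_def y_in_coord_ring subring_zero[OF coord_ring_subring])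
  finally show ?thesis .
qed

text \<open>With \<open>N = q m\<close> and \<open>q\<close> a power of \<open>p\<close>, \<open>N choose q\<close> equals \<open>m\<close> times \<open>(N - 1) choose (q - 1)\<close>, and the
  latter is prime to \<open>p\<close>.  Take \<open>m = p\<close> if \<open>N\<close> is a power of \<open>p\<close>, and \<open>m\<close> prime to \<open>p\<close> otherwise.\<close>

lemma binomial_unit:
  assumes N: "N > 1"
  obtains j b where "0 < j" "j < N" "log_lead p N * of_nat (N choose j) = of_nat b" "\<not> p dvd b"
proof -
  have "\<exists>q m. N = q * m \<and> (\<exists>c. q = p ^ c) \<and> m > 1 \<and> (if prime_power p N then m = p else \<not> p dvd m)"
  proof (cases "prime_power p N")
    case True
    then obtain i where "i > 0" "N = p ^ i" by (auto simp: prime_power_def)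
    then have "N = p ^ (i - 1) * p" by (cases i) simp_all
    then show ?thesis using True p_gt_1 by auto
  next
    case False
    obtain m where m: "N = p ^ multiplicity p N * m" "\<not> p dvd m"
      by (rule multiplicity_decompose'[of N p]) (use N p_gt_1 in auto)
    have "m \<noteq> 0" using m(2) by (metis dvd_0_right)
    moreover have "m \<noteq> 1"
    proof
      assume "m = 1"
      then have N_eq: "N = p ^ multiplicity p N" using m(1) by (metis mult_1_right)
      then have "multiplicity p N > 0" using N by (metis gr0I less_irrefl power_0)
      then show False using False N_eq unfolding prime_power_def by blast
    qed
    ultimately have "m > 1" by simp
    then show ?thesis using False m by metis
  qed
  then obtain q m c where qm: "N = q * m" "q = p ^ c" "m > 1"
    "if prime_power p N then m = p else \<not> p dvd m" by blast
  have q: "q > 0" using qm p_gt_1 by simp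
  have "q * (N choose q) = N * (N - 1 choose (q - 1))"
    using binomial_absorption[of "q - 1" N] q by simp
  then have choose: "N choose q = m * (N - 1 choose (q - 1))"
    using q by (simp add: qm(1))
  have unit: "\<not> p dvd (N - 1 choose (q - 1))"
    using prime_not_dvd_choose[OF prime_p, of c N "q - 1"] q N qm by simp
  show thesis
  proof (cases "prime_power p N")
    case True
    then have "log_lead p N * of_nat (N choose q) = of_nat (N - 1 choose (q - 1))"
      using qm(4) p_gt_1 by (simp add: log_lead_def choose)
    then show ?thesis using that[of q] q qm(1,3) unit by simp
  next
    case False
    then have "\<not> p dvd (N choose q)"
      using unit qm(4) prime_p by (simp add: choose prime_dvd_mult_iff)
    then show ?thesis using that[of q "N choose q"] False q qm(1,3) by (simp add: log_lead_def)
  qed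
qed

end

lemma tensor_Z_at_scalar_mult:
  "q \<in> Z_at p \<Longrightarrow> x \<in> tensor_Z_at M p \<Longrightarrow> scalar q * x \<in> tensor_Z_at M p"
  unfolding tensor_Z_at_def by (rule submodule_smult[OF module_span_submodule]) auto

lemma OmegaU_subring: "is_subring OmegaU"
  unfolding OmegaU_def by (rule is_subring_hull)

lemma fglU_in_OmegaU: "fglU i j \<in> OmegaU"
  unfolding OmegaU_def by (rule hull_inc) auto

text \<open>Two minimality arguments, one in each factor, since both tensor products are spans.\<close>

lemma tensor_Z_at_mult_closed:
  assumes M: "is_submodule OmegaU M" and r: "r \<in> tensor_Z_at OmegaU p" and x: "x \<in> tensor_Z_at M p"
  shows "r * x \<in> tensor_Z_at M p"
proof -
  let ?Z = "scalar ` Z_at p"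
  have T: "is_submodule ?Z (tensor_Z_at M p)"
    unfolding tensor_Z_at_def by (rule module_span_submodule)
  have "tensor_Z_at M p \<subseteq> {x. r * x \<in> tensor_Z_at M p}" if r: "r \<in> OmegaU" for r
  proof (subst (1) tensor_Z_at_def, rule module_span_minimal)
    show "M \<subseteq> {x. r * x \<in> tensor_Z_at M p}"
      using submodule_smult[OF M r] unfolding tensor_Z_at_def by (auto intro: module_span_inc)
    show "is_submodule ?Z {x. r * x \<in> tensor_Z_at M p}"
      using T by (auto simp: is_submodule_def distrib_left mult.left_commute[of r])
  qed
  then have "OmegaU \<subseteq> {r. r * x \<in> tensor_Z_at M p}" using x by auto
  moreover have "is_submodule ?Z {r. r * x \<in> tensor_Z_at M p}"
    using T by (auto simp: is_submodule_def distrib_right mult.assoc)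
  ultimately have "tensor_Z_at OmegaU p \<subseteq> {r. r * x \<in> tensor_Z_at M p}"
    by (subst (1) tensor_Z_at_def) (rule module_span_minimal)
  then show ?thesis using r by auto
qed

lemma subset_tensor_Z_at: "M \<subseteq> tensor_Z_at M p"
  unfolding tensor_Z_at_def by (auto intro: module_span_inc)

lemma tensor_OmegaU_subring: "is_subring (tensor_Z_at OmegaU p)"
proof -
  let ?R = "tensor_Z_at OmegaU p"
  have sub: "is_submodule OmegaU OmegaU"
    using OmegaU_subring by (auto simp: is_submodule_def intro: subring_zero subring_add subring_mult)
  have mult: "r * x \<in> ?R" if "r \<in> ?R" "x \<in> ?R" for r x
    using that by (rule tensor_Z_at_mult_closed[OF sub])
  have one: "1 \<in> ?R"
    using subset_tensor_Z_at subring_one[OF OmegaU_subring] by blast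
  have "scalar (of_int (-1)) * x \<in> ?R" if "x \<in> ?R" for x
    using that by (intro tensor_Z_at_scalar_mult Z_at_of_int)
  then have uminus: "- x \<in> ?R" if "x \<in> ?R" for x
    using that by (simp add: scalar_uminus)
  have add: "x + y \<in> ?R" if "x \<in> ?R" "y \<in> ?R" for x y
    using that unfolding tensor_Z_at_def by (rule submodule_add[OF module_span_submodule])
  show ?thesis
    using mult one add uminus unfolding is_subring_def
    by (metis diff_conv_add_uminus)
qed

lemma powU_0: "powU k $ 0 = 0"
  by (simp add: powU_def expU_def fps_rev_def)

lemma logU_powU: "logU oo powU k = of_nat k * logU"
proof -
  have "logU oo powU k = (logU oo expU) oo (of_nat k * logU)"
    unfolding powU_def by (rule fps_compose_assoc) (simp_all add: expU_def fps_rev_def)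
  then show ?thesis by (simp add: logU_expU)
qed

context hazewinkel
begin

text \<open>Every coefficient of the group law is integral by the functional equation lemma.  Conversely,
  a suitable coefficient of total degree \<open>N\<close> contains the generator \<open>y\<^sub>N\<close> with a coefficient that is
  invertible at \<open>p\<close>, so the generators can be recovered one after the other.\<close>

theorem tensor_OmegaU_eq_coord_ring: "tensor_Z_at OmegaU p = coord_ring UNIV"
proof
  let ?S = "coord_ring UNIV" and ?R = "tensor_Z_at OmegaU p"
  have "fglU i j \<in> ?S" for i j
    using log_series_homog_fgl_integral[OF log_series_logU coord_ring_lift y_in_coord_ring, of UNIV "i + j" j]
    by (simp add: homog_fgl_nth)
  then have "OmegaU \<subseteq> ?S"
    unfolding OmegaU_def by (intro hull_minimal coord_ring_subring) auto
  moreover have "is_submodule (scalar ` Z_at p) ?S"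
    by (auto simp: is_submodule_def intro!: subring_zero[OF coord_ring_subring]
        subring_add[OF coord_ring_subring] subring_mult[OF coord_ring_subring] scalar_in_coord_ring)
  ultimately show "?R \<subseteq> ?S"
    unfolding tensor_Z_at_def by (rule module_span_minimal)
  have scalars: "scalar ` Z_at p \<subseteq> ?R"
    using tensor_Z_at_scalar_mult[of _ p 1 OmegaU] subring_one[OF tensor_OmegaU_subring] by auto
  have y_in: "y N \<in> ?R" for N
  proof (induction N rule: less_induct)
    case (less N)
    show ?case
    proof (cases "N > 1")
      case True
      obtain j b where jb: "0 < j" "j < N" "log_lead p N * of_nat (N choose j) = of_nat b" "\<not> p dvd b"
        using binomial_unit[OF True] .
      have "coord_ring {..<N} \<subseteq> ?R"
        unfolding coord_ring_def using less scalars
        by (intro hull_minimal tensor_OmegaU_subring) auto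
      then have "fglU (N - j) j + scalar (log_lead p N) * of_nat (N choose j) * y N \<in> ?R"
        using fglU_top_generator[OF True jb(1,2)] by blast
      also have "scalar (log_lead p N) * of_nat (N choose j) * y N = scalar (of_nat b) * y N"
        by (simp only: jb(3)[symmetric] scalar_mult scalar_of_nat)
      finally have "scalar (of_nat b) * y N \<in> ?R"
        using subring_diff[OF tensor_OmegaU_subring _ subsetD[OF subset_tensor_Z_at fglU_in_OmegaU]]
        by (metis add_diff_cancel_left')
      moreover have "b \<noteq> 0" "coprime (int b) (int p)"
        using jb(4) prime_imp_coprime[OF prime_p, of b] by (auto simp: coprime_commute intro: ccontr)
      then have inv: "1 / of_int (int b) \<in> Z_at p" by (intro Z_at_inverse) auto
      ultimately have "scalar (1 / of_int (int b)) * (scalar (of_nat b) * y N) \<in> ?R"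
        by (rule tensor_Z_at_scalar_mult[rotated])
      then show ?thesis using \<open>b \<noteq> 0\<close> by (simp flip: mult.assoc scalar_mult)
    next
      case False
      then consider "N = 0" | "N = 1" by linarith
      then show ?thesis
        using y_0 y_1 subring_zero[OF tensor_OmegaU_subring] subring_one[OF tensor_OmegaU_subring]
        by cases simp_all
    qed
  qed
  show "?S \<subseteq> ?R"
    unfolding coord_ring_def using scalars y_in by (intro hull_minimal tensor_OmegaU_subring) auto
qed

section \<open>The ideal of the power operations\<close>

text \<open>The functional equation lemma gives \<open>b(E) = k b(u)\<close> modulo the \<open>z (p^i)\<close>, where \<open>b\<close> is \<open>u\<close> plus the
  terms \<open>z\<^sub>n u^n\<close> over the \<open>n > 1\<close> that are not powers of \<open>p\<close>.  If \<open>k^n z\<^sub>n = k z\<^sub>n\<close> modulo \<open>J\<close>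
  for these \<open>n\<close>, then also \<open>b(k u) = k b(u)\<close> modulo \<open>J\<close>, and \<open>b\<close> can be cancelled.\<close>

lemma multiplication_series_in_ideal:
  assumes f: "log_series z f" and S: "frobenius_lift \<sigma> p S" and z: "\<And>k. z k \<in> S"
    and J: "is_submodule S J"
    and power: "\<And>i. i > 0 \<Longrightarrow> z (p ^ i) \<in> J"
    and nonpower: "\<And>n. n > 1 \<Longrightarrow> \<not> prime_power p n \<Longrightarrow> (of_nat k ^ n - of_nat k) * z n \<in> J"
    and E: "E $ 0 = 0" "f oo E = of_nat k * f"
    and n: "n > 1"
  shows "E $ n \<in> J"
proof -
  interpret S: frobenius_lift \<sigma> p S by fact
  let ?b = "base_series p z"
  have b: "?b \<in> coeffs_in S" by (rule base_series_in[OF z S.subring])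
  have z01: "z 0 = 0" "z 1 = 1" using f by (simp_all add: log_series_def)
  note b01 = base_series_nth_01(1)[of z, OF z01(1)] base_series_nth_01(2)[of z, OF z01(2)]
  have feq: "functional_eq p (scalar (1 / of_nat p)) \<sigma> (\<lambda>i. z (p ^ i)) ?b f"
    using f by (simp add: log_series_def)
  have \<pi>: "of_nat p * scalar (1 / of_nat p) = 1"
    using p_gt_1 by (intro scalar_inverse) simp
  have kb: "of_nat k * ?b \<in> coeffs_in S" "(of_nat k * ?b) $ 0 = 0"
    using coeffs_inD[OF b] subring_mult[OF S.subring subring_of_nat[OF S.subring]] b01
    by (auto simp: coeffs_in_def simp flip: fps_of_nat)
  note fe_lemma = functional_equation_lemma[OF S \<pi> z b b01 kb feq
      functional_eq_of_nat[OF comm_ring_hom_axioms feq] E]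
  have ES: "E \<in> coeffs_in S" by (rule fe_lemma(1))
  have "module_span S {z (p ^ i) | i. i > 0} \<subseteq> J"
    using power by (intro module_span_minimal J) auto
  then have bE: "(?b oo E) $ n - of_nat k * ?b $ n \<in> J" for n
    using fe_lemma(2)[of n] by (auto simp flip: fps_of_nat)
  define L where "L = fps_const (of_nat k :: cobordism_rat) * fps_X"
  have L: "L \<in> coeffs_in S" "L $ 0 = 0"
    using subring_zero[OF S.subring] subring_of_nat[OF S.subring]
    by (auto simp: L_def coeffs_in_def fps_X_def)
  have bL: "(?b oo L) $ n = of_nat k ^ n * ?b $ n" for n
    unfolding L_def by (rule fps_nth_compose_linear)
  have "E $ n - L $ n \<in> J" for n
  proof (induction n rule: less_induct)
    case (less n)
    show ?case
    proof (cases "n = 0")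
      case False
      then have n0: "n > 0" by simp
      have tail: "(\<Sum>m=2..n. ?b $ m * (E ^ m) $ n) - (\<Sum>m=2..n. ?b $ m * (L ^ m) $ n) \<in> J"
        unfolding sum_subtractf[symmetric] right_diff_distrib[symmetric]
        by (intro submodule_sum[OF J] submodule_smult[OF J] coeffs_inD[OF b]
            power_nth_cong[OF S.subring J ES L(1) E(1) L(2)] less.IH) auto
      have lin: "(of_nat k ^ n - of_nat k) * ?b $ n \<in> J"
      proof (cases "n = 1 \<or> prime_power p n")
        case True
        then show ?thesis using submodule_zero[OF J] by (auto simp: base_series_def)
      next
        case False
        then show ?thesis using nonpower[of n] n0 by (simp add: base_series_def)
      qed
      have "E $ n - L $ n = ((?b oo E) $ n - of_nat k * ?b $ n) - (of_nat k ^ n - of_nat k) * ?b $ n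
          - ((\<Sum>m=2..n. ?b $ m * (E ^ m) $ n) - (\<Sum>m=2..n. ?b $ m * (L ^ m) $ n))"
        using compose_nth_linear[OF E(1) n0, of ?b] compose_nth_linear[OF L(2) n0, of ?b] bL[of n] b01
        by (simp add: algebra_simps)
      then show ?thesis
        using bE[of n] lin tail by (simp add: submodule_diff[OF J S.subring])
    qed (simp add: E L submodule_zero[OF J])
  qed
  from this[of n] show ?thesis using n by (simp add: L_def)
qed

text \<open>The factor \<open>p\<close> appears where \<open>k^n - k\<close> is divisible by \<open>p\<close> for all \<open>k\<close> and the
  logarithm has no denominator \<open>p\<close> to cancel it.\<close>

definition ideal_gen :: "nat \<Rightarrow> cobordism_rat" where
  "ideal_gen n = (if prime_power p n \<or> \<not> (p - 1) dvd (n - 1) then y n else of_nat p * y n)"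

lemma prime_power_dvd_pred: "prime_power p n \<Longrightarrow> (p - 1) dvd (n - 1)"
proof -
  assume "prime_power p n"
  then obtain i where "n = p ^ i" by (auto simp: prime_power_def)
  moreover have "int p - 1 dvd int p ^ i - 1"
    by (rule dvdI[of _ _ "\<Sum>j<i. int p ^ j"]) (simp add: power_diff_1_eq)
  ultimately have "int (p - 1) dvd int (n - 1)"
    using p_gt_1 by (simp add: of_nat_diff)
  then show ?thesis by (simp only: int_dvd_int_iff)
qed

text \<open>As for the group law, \<open>[u]\<^sub>k\<close> is compared with its analogue for the truncated logarithm, which
  lies in the ideal by the preceding lemma; the perturbation formula contributes \<open>k - k^N\<close>.\<close>

lemma powU_top_generator:
  assumes N: "N > 1"
  shows "powU k $ N - scalar ((of_nat k - of_nat k ^ N) * log_lead p N) * y N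
    \<in> module_span (coord_ring UNIV) (ideal_gen ` {1<..<N})"
proof -
  let ?S = "coord_ring UNIV" and ?J = "module_span (coord_ring UNIV) (ideal_gen ` {1<..<N})"
  let ?f = "truncated_log N"
  let ?e = "scalar (log_lead p N) * y N"
  note f = log_series_truncated[OF N]
  note f01 = log_series_nth_01[OF f]
  define E where "E = fps_rev ?f oo (of_nat k * ?f)"
  have E0: "E $ 0 = 0" by (simp add: E_def fps_rev_def)
  have "?f oo E = (?f oo fps_rev ?f) oo (of_nat k * ?f)"
    unfolding E_def by (rule fps_compose_assoc) (simp_all add: f01 fps_rev_def)
  then have fE: "?f oo E = of_nat k * ?f"
    using fps_rev_right[OF f01] f01 by simp
  have nth_k: "(of_nat k * h) $ n = of_nat k * h $ n" for h :: "cobordism_rat fps" and n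
    by (simp flip: fps_of_nat)
  have J: "is_submodule ?S ?J" by (rule module_span_submodule)
  have gen_in: "ideal_gen n \<in> ?J" if "1 < n" "n < N" for n
    using that by (intro module_span_inc) auto
  have "E $ N \<in> ?J"
  proof (rule multiplication_series_in_ideal[OF f coord_ring_lift _ J _ _ E0 fE N])
    show "truncated N n \<in> ?S" for n
      using subring_zero[OF coord_ring_subring] by (simp add: truncated_def y_in_coord_ring)
    show "truncated N (p ^ i) \<in> ?J" if "i > 0" for i
    proof -
      have "prime_power p (p ^ i)" using that unfolding prime_power_def by blast
      then have "ideal_gen (p ^ i) = y (p ^ i)" by (simp add: ideal_gen_def)
      then show ?thesis
        using gen_in[of "p ^ i"] one_less_power[OF p_gt_1 that] submodule_zero[OF J]
        by (auto simp: truncated_def)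
    qed
    show "(of_nat k ^ n - of_nat k) * truncated N n \<in> ?J" if n: "n > 1" "\<not> prime_power p n" for n
    proof (cases "n < N")
      case True
      show ?thesis
      proof (cases "(p - 1) dvd (n - 1)")
        case dvd: True
        obtain c where c: "int k ^ n - int k = int p * c"
          using prime_dvd_power_diff_self[OF prime_p dvd] n by auto
        have "(of_nat k ^ n - of_nat k :: cobordism_rat) = of_int (int k ^ n - int k)" by simp
        then have "(of_nat k ^ n - of_nat k) * truncated N n = of_int c * ideal_gen n"
          using n dvd True unfolding c by (simp add: truncated_def ideal_gen_def mult_ac)
        then show ?thesis
          by (simp only:) (intro submodule_smult[OF J] subring_of_int[OF coord_ring_subring] gen_in n(1) True)
      next
        case False
        have "(of_nat k ^ n - of_nat k) * truncated N n = of_int (int k ^ n - int k) * ideal_gen n"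
          using False True by (simp add: truncated_def ideal_gen_def)
        then show ?thesis
          by (simp only:) (intro submodule_smult[OF J] subring_of_int[OF coord_ring_subring] gen_in n(1) True)
      qed
    qed (use submodule_zero[OF J] in \<open>simp add: truncated_def\<close>)
  qed
  moreover have "powU k $ N = E $ N + ((logU oo powU k) $ N - (?f oo E) $ N)
      - (logU $ N - ?f $ N) * (E $ 1) ^ N"
  proof (rule compose_perturb[OF powU_0 E0 _ f01(2) _ _ N])
    show "(logU oo powU k) $ j = (?f oo E) $ j" if "j < N" for j
      by (simp add: fE logU_powU nth_k truncated_log_below[OF N that])
  qed (simp_all add: truncated_log_below[OF N])
  moreover have "E $ 1 = of_nat k"
    using compose_nth_linear[OF E0, of 1 ?f] f01 by (simp add: fE nth_k)
  moreover have "(logU oo powU k) $ N - (?f oo E) $ N = of_nat k * ?e"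
    unfolding fE logU_powU nth_k truncated_log_at[OF N, symmetric] by (simp add: algebra_simps)
  moreover have "scalar ((of_nat k - of_nat k ^ N) * log_lead p N) * y N = of_nat k * ?e - ?e * of_nat k ^ N"
    by (simp add: scalar_mult scalar_diff scalar_of_nat algebra_simps flip: scalar_power)
  ultimately show ?thesis
    by (simp add: truncated_log_at[OF N])
qed

lemma powU_top_term_in_ideal:
  assumes N: "N > 1"
  obtains q where "q \<in> Z_at p"
    "scalar ((of_nat k - of_nat k ^ N) * log_lead p N) * y N = scalar q * ideal_gen N"
proof (cases "(p - 1) dvd (N - 1)")
  case True
  obtain c where c: "int k ^ N - int k = int p * c"
    using prime_dvd_power_diff_self[OF prime_p True] N by auto
  have "(of_nat k - of_nat k ^ N :: rat) = - of_int (int k ^ N - int k)" by simp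
  then have k: "(of_nat k - of_nat k ^ N :: rat) = of_nat p * of_int (- c)" unfolding c by simp
  have "scalar ((of_nat k - of_nat k ^ N) * log_lead p N) * y N = scalar (of_int (- c)) * ideal_gen N"
    unfolding k using True p_gt_1 scalar_inverse[of p]
    by (auto simp: log_lead_def ideal_gen_def scalar_mult scalar_of_nat scalar_uminus)
  then show thesis using that[OF Z_at_of_int] by blast
next
  case False
  then have "\<not> prime_power p N" using prime_power_dvd_pred by blast
  then have "scalar ((of_nat k - of_nat k ^ N) * log_lead p N) * y N
      = scalar (of_int (int k - int k ^ N)) * ideal_gen N"
    using False by (simp add: log_lead_def ideal_gen_def)
  then show thesis using that[OF Z_at_of_int] by blast
qed

lemma ideal_gen_from_top_term:
  assumes N: "N > 1"
    and k: "if (p - 1) dvd (N - 1) then k = p else coprime (int k - int k ^ N) (int p)"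
  obtains q where "q \<in> Z_at p"
    "ideal_gen N = scalar q * (scalar ((of_nat k - of_nat k ^ N) * log_lead p N) * y N)"
proof (cases "(p - 1) dvd (N - 1)")
  case True
  define b where "b = 1 - int p ^ (N - 1)"
  have "int p dvd int p ^ (N - 1)" using N by simp
  then have "coprime b (int p)"
    unfolding b_def by (intro coprimeI) (metis dvd_add diff_add_cancel dvd_trans)
  moreover have "int p ^ (N - 1) > 1" using N p_gt_1 by (intro one_less_power) auto
  then have b0: "b \<noteq> 0" by (simp add: b_def)
  ultimately have q: "1 / of_int b \<in> Z_at p" by (rule Z_at_inverse[rotated])
  have pN: "of_nat p - of_nat p ^ N = (of_nat p * of_int b :: rat)"
    using N by (simp add: b_def algebra_simps flip: power_Suc)
  have "ideal_gen N = scalar (1 / of_int b) * (scalar ((of_nat p * of_int b) * log_lead p N) * y N)"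
    using True p_gt_1 b0
    by (simp add: ideal_gen_def log_lead_def scalar_of_nat flip: scalar_mult mult.assoc)
  then show thesis using that[OF q] k True pN by simp
next
  case False
  define b where "b = int k - int k ^ N"
  have "coprime b (int p)" using k False by (simp add: b_def)
  moreover from this have b0: "b \<noteq> 0" using p_gt_1 by auto
  ultimately have q: "1 / of_int b \<in> Z_at p" by (rule Z_at_inverse[rotated])
  have kN: "of_nat k - of_nat k ^ N = (of_int b :: rat)" by (simp add: b_def)
  have "\<not> prime_power p N" using False prime_power_dvd_pred by blast
  then have "ideal_gen N = scalar (1 / of_int b) * (scalar (of_int b * log_lead p N) * y N)"
    using False b0 by (simp add: ideal_gen_def log_lead_def flip: scalar_mult mult.assoc)
  then show thesis using that[OF q] kN by simp
qed

lemma powU_in_ideal: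
  assumes N: "N > 1"
  shows "powU k $ N \<in> module_span (coord_ring UNIV) (ideal_gen ` {1<..})"
proof -
  let ?J = "module_span (coord_ring UNIV) (ideal_gen ` {1<..})"
  have J: "is_submodule (coord_ring UNIV) ?J" by (rule module_span_submodule)
  obtain q where q: "q \<in> Z_at p"
    "scalar ((of_nat k - of_nat k ^ N) * log_lead p N) * y N = scalar q * ideal_gen N"
    using powU_top_term_in_ideal[OF N] .
  have "ideal_gen N \<in> ?J" using N by (intro module_span_inc) auto
  then have "scalar ((of_nat k - of_nat k ^ N) * log_lead p N) * y N \<in> ?J"
    unfolding q(2) by (intro submodule_smult[OF J] scalar_in_coord_ring q)
  moreover have "module_span (coord_ring UNIV) (ideal_gen ` {1<..<N}) \<subseteq> ?J"
    by (rule module_span_mono) auto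
  ultimately show ?thesis
    using submodule_add[OF J subsetD[OF _ powU_top_generator[OF N, of k]]] by fastforce
qed

text \<open>Each generator of the ideal is a unit multiple of the power series coefficient in its
  degree, modulo the generators of lower degree.\<close>

theorem ideal_generated_by_powU:
  assumes k: "\<And>N. N > 1 \<Longrightarrow> if (p - 1) dvd (N - 1) then k N = p else coprime (int (k N) - int (k N) ^ N) (int p)"
    and N: "N > 1"
  shows "powU l $ N \<in> module_span (coord_ring UNIV) ((\<lambda>N. powU (k N) $ N) ` {1<..})"
proof -
  let ?I = "module_span (coord_ring UNIV) ((\<lambda>N. powU (k N) $ N) ` {1<..})"
  have I: "is_submodule (coord_ring UNIV) ?I" by (rule module_span_submodule)
  have gen: "ideal_gen N \<in> ?I" if "N > 1" for N
    using that
  proof (induction N rule: less_induct)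
    case (less N)
    obtain q where q: "q \<in> Z_at p" "ideal_gen N
        = scalar q * (scalar ((of_nat (k N) - of_nat (k N) ^ N) * log_lead p N) * y N)"
      using ideal_gen_from_top_term[OF less.prems k[OF less.prems]] .
    have "module_span (coord_ring UNIV) (ideal_gen ` {1<..<N}) \<subseteq> ?I"
      using less by (intro module_span_minimal I) auto
    then have "powU (k N) $ N - scalar ((of_nat (k N) - of_nat (k N) ^ N) * log_lead p N) * y N \<in> ?I"
      using powU_top_generator[OF less.prems, of "k N"] by blast
    moreover have "powU (k N) $ N \<in> ?I"
      using less.prems by (intro module_span_inc) auto
    ultimately have "powU (k N) $ N - (powU (k N) $ N
        - scalar ((of_nat (k N) - of_nat (k N) ^ N) * log_lead p N) * y N) \<in> ?I"
      by (rule submodule_diff[OF I coord_ring_subring, rotated])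
    then have "scalar ((of_nat (k N) - of_nat (k N) ^ N) * log_lead p N) * y N \<in> ?I" by simp
    then show ?case
      unfolding q(2) by (rule submodule_smult[OF I scalar_in_coord_ring[OF q(1)]])
  qed
  then have "module_span (coord_ring UNIV) (ideal_gen ` {1<..}) \<subseteq> ?I"
    by (intro module_span_minimal I) auto
  then show ?thesis using powU_in_ideal[OF N] by blast
qed

end

section \<open>Grading\<close>

lemma keys_sum_subset: "Poly_Mapping.keys (sum f I) \<subseteq> (\<Union>i\<in>I. Poly_Mapping.keys (f i))"
proof (induction I rule: infinite_finite_induct)
  case (insert i I)
  then show ?case using keys_add[of "f i" "sum f I"] by auto
qed auto

lemma cdim_superset:
  "finite T \<Longrightarrow> Poly_Mapping.keys m \<subseteq> T \<Longrightarrow> cdim m = (\<Sum>i\<in>T. Suc i * Poly_Mapping.lookup m i)"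
  unfolding cdim_def by (intro sum.mono_neutral_left) (auto simp: in_keys_iff)

lemma cdim_add: "cdim (m + n) = cdim m + cdim n"
proof -
  let ?T = "Poly_Mapping.keys m \<union> Poly_Mapping.keys n"
  have "cdim (m + n) = (\<Sum>i\<in>?T. Suc i * Poly_Mapping.lookup (m + n) i)"
    by (rule cdim_superset) (use keys_add[of m n] in auto)
  also have "\<dots> = (\<Sum>i\<in>?T. Suc i * Poly_Mapping.lookup m i) + (\<Sum>i\<in>?T. Suc i * Poly_Mapping.lookup n i)"
    by (simp add: lookup_add distrib_left sum.distrib del: mult_Suc)
  also have "\<dots> = cdim m + cdim n"
    by (simp add: cdim_superset[of ?T] del: mult_Suc)
  finally show ?thesis .
qed

lemma cdim_zero [simp]: "cdim 0 = 0"
  by (simp add: cdim_def)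

text \<open>Giving \<open>u\<close> the degree \<open>-1\<close>, a series of weight \<open>w\<close> is homogeneous of degree \<open>-w\<close>.\<close>

definition weight :: "nat \<Rightarrow> cobordism_rat fps \<Rightarrow> bool" where
  "weight w f \<longleftrightarrow> (\<forall>n. \<forall>m\<in>Poly_Mapping.keys (f $ n). cdim m + w = n)"

lemma weightD: "weight w f \<Longrightarrow> m \<in> Poly_Mapping.keys (f $ n) \<Longrightarrow> cdim m + w = n"
  by (auto simp: weight_def)

lemma weight_add: "weight w f \<Longrightarrow> weight w g \<Longrightarrow> weight w (f + g)"
  unfolding weight_def using keys_add by fastforce

lemma weight_mult:
  assumes "weight v f" "weight w g"
  shows "weight (v + w) (f * g)"
  unfolding weight_def
proof (intro allI ballI)
  fix n m assume "m \<in> Poly_Mapping.keys ((f * g) $ n)"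
  then obtain i where "i \<in> {0..n}" "m \<in> Poly_Mapping.keys (f $ i * g $ (n - i))"
    unfolding fps_mult_nth using keys_sum_subset by fast
  moreover from this obtain a b where "m = a + b" "a \<in> Poly_Mapping.keys (f $ i)"
    "b \<in> Poly_Mapping.keys (g $ (n - i))"
    using keys_mult by blast
  ultimately show "cdim m + (v + w) = n"
    using weightD[OF assms(1)] weightD[OF assms(2)] by (fastforce simp: cdim_add)
qed

lemma weight_power: "weight 1 f \<Longrightarrow> weight k (f ^ k)"
proof (induction k)
  case 0
  then show ?case by (simp add: weight_def fps_one_nth)
next
  case (Suc k)
  then show ?case using weight_mult[of 1 f k "f ^ k"] by simp
qed

lemma weight_of_nat_mult: "weight w f \<Longrightarrow> weight w (of_nat k * f)"
proof (induction k)
  case (Suc k)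
  then show ?case using weight_add[of w f "of_nat k * f"] by (simp add: distrib_right)
qed (simp add: weight_def)

lemma weight_logU: "weight 1 logU"
proof -
  have "m \<in> Poly_Mapping.keys (CP k) \<Longrightarrow> cdim m = k" for m k
    by (cases k) (simp_all add: CP_def cdim_def)
  moreover have "m \<in> Poly_Mapping.keys (scalar q * x) \<Longrightarrow> m \<in> Poly_Mapping.keys x" for m q x
    using keys_mult[of "scalar q" x] by (auto simp: scalar_def split: if_splits)
  ultimately show ?thesis by (fastforce simp: weight_def logU_def)
qed

lemma weight_compose:
  assumes "weight 1 f" "weight 1 g"
  shows "weight 1 (f oo g)"
  unfolding weight_def
proof (intro allI ballI)
  fix n m assume "m \<in> Poly_Mapping.keys ((f oo g) $ n)"
  then obtain i where "m \<in> Poly_Mapping.keys (f $ i * (g ^ i) $ n)"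
    unfolding fps_compose_nth using keys_sum_subset by fast
  then obtain a b where "m = a + b" "a \<in> Poly_Mapping.keys (f $ i)" "b \<in> Poly_Mapping.keys ((g ^ i) $ n)"
    using keys_mult by blast
  then show "cdim m + 1 = n"
    using weightD[OF assms(1)] weightD[OF weight_power[OF assms(2)]] by (fastforce simp: cdim_add)
qed

lemma weight_expU: "weight 1 expU"
  unfolding weight_def
proof (intro allI)
  fix n
  show "\<forall>m\<in>Poly_Mapping.keys (expU $ n). cdim m + 1 = n"
  proof (induction n rule: less_induct)
    case (less n)
    show ?case
    proof (cases n)
      case (Suc l)
      let ?s = "\<Sum>i=0..l. expU $ i * (logU ^ i) $ n"
      have "expU $ n = fps_X $ n + - ?s" by (simp add: Suc expU_def fps_rev_def)
      moreover have "cdim m + 1 = n" if "m \<in> Poly_Mapping.keys (- ?s)" for m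
      proof -
        have "m \<in> Poly_Mapping.keys ?s" using that by (simp add: in_keys_iff)
        then obtain i where i: "i \<in> {0..l}" "m \<in> Poly_Mapping.keys (expU $ i * (logU ^ i) $ n)"
          using keys_sum_subset by fast
        then obtain a b where "m = a + b" "a \<in> Poly_Mapping.keys (expU $ i)" "b \<in> Poly_Mapping.keys ((logU ^ i) $ n)"
          using keys_mult by blast
        then show ?thesis
          using less.IH[of i] i(1) Suc weightD[OF weight_power[OF weight_logU]] by (fastforce simp: cdim_add)
      qed
      moreover have "cdim m + 1 = n" if "m \<in> Poly_Mapping.keys (fps_X $ n :: cobordism_rat)" for m
        using that by (auto simp: fps_X_def split: if_splits)
      ultimately show ?thesis using keys_add[of "fps_X $ n" "- ?s"] by auto
    qed (simp add: expU_def fps_rev_def)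
  qed
qed

lemma weight_powU: "weight 1 (powU k)"
  unfolding powU_def by (intro weight_compose weight_expU weight_of_nat_mult weight_logU)

section \<open>Integrality of the power operations\<close>

lemma compose_mult_nth:
  fixes g P h :: "'a::comm_ring_1 fps"
  assumes P: "P $ 0 = 0"
  shows "((g oo P) * h) $ n = (\<Sum>i\<le>n. \<Sum>j\<le>n. g $ i * h $ j * (P ^ i * fps_X ^ j) $ n)"
proof -
  have ext: "(g oo P) $ l = (\<Sum>i\<le>n. g $ i * (P ^ i) $ l)" if "l \<le> n" for l
    unfolding fps_compose_nth using that startsby_zero_power_prefix[OF P]
    by (intro sum.mono_neutral_left) auto
  have "((g oo P) * h) $ n = (\<Sum>j\<le>n. (g oo P) $ (n - j) * h $ j)"
    unfolding mult.commute[of "g oo P"] fps_mult_nth by (simp add: atMost_atLeast0 mult.commute)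
  also have "\<dots> = (\<Sum>j\<le>n. \<Sum>i\<le>n. g $ i * h $ j * (P ^ i * fps_X ^ j) $ n)"
  proof (intro sum.cong refl)
    fix j assume "j \<in> {..n}"
    then have "(P ^ i * fps_X ^ j) $ n = (P ^ i) $ (n - j)" for i
      by (simp add: fps_X_power_mult_right_nth)
    then show "(g oo P) $ (n - j) * h $ j = (\<Sum>i\<le>n. g $ i * h $ j * (P ^ i * fps_X ^ j) $ n)"
      by (simp add: ext sum_distrib_right sum_distrib_left mult_ac)
  qed
  also have "\<dots> = (\<Sum>i\<le>n. \<Sum>j\<le>n. g $ i * h $ j * (P ^ i * fps_X ^ j) $ n)"
    by (rule sum.swap)
  finally show ?thesis .
qed

lemma in_xy_power_nth:
  fixes f :: "'a::comm_ring_1 fps"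
  shows "((in_x f + in_y f) ^ k) $ j $ i
    = (\<Sum>a\<le>k. of_nat (k choose a) * ((f ^ a) $ i * (f ^ (k - a)) $ j))"
proof -
  interpret C: comm_ring_hom "fps_const :: 'a fps \<Rightarrow> _" by (rule fps_const_hom)
  interpret M: comm_ring_hom "map_fps fps_const :: 'a fps \<Rightarrow> _"
    by (rule comm_ring_hom.hom_map_fps[OF fps_const_hom])
  have of_nat_nth: "(of_nat c * g) $ j $ i = of_nat c * g $ j $ i" for c and g :: "'a fps fps"
    by (simp flip: fps_of_nat)
  have "(fps_const g * map_fps fps_const h) $ j $ i = g $ i * h $ j" for g h :: "'a fps"
    by simp
  then show ?thesis
    unfolding in_xy_eq binomial_ring fps_sum_nth mult.assoc of_nat_nth
      M.hom_power[symmetric] C.hom_power[symmetric] by simp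
qed

text \<open>\<open>[u]\<^sub>k\<^sub>+\<^sub>1 = F([u]\<^sub>k, u)\<close>, expanded into coefficients.  Terms with \<open>i > n\<close> or \<open>j > n\<close> have no
  coefficient in degree \<open>n\<close>, so finite sums suffice.\<close>

lemma powU_Suc_nth:
  "powU (Suc k) $ n = (\<Sum>i\<le>n. \<Sum>j\<le>n. fglU i j * (powU k ^ i * fps_X ^ j) $ n)"
proof -
  let ?P = "powU k"
  have P0: "?P $ 0 = 0" by (simp add: powU_def expU_def fps_rev_def)
  have logP: "logU oo ?P = of_nat k * logU"
    by (rule logU_powU)
  have nat_nth: "(of_nat c * g) $ n = of_nat c * g $ n" for c and g :: "cobordism_rat fps"
    by (simp flip: fps_of_nat)
  have fgl: "(\<Sum>K\<le>n. expU $ K * ((in_x logU + in_y logU) ^ K) $ j $ i) * (?P ^ i * fps_X ^ j) $ n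
      = fglU i j * (?P ^ i * fps_X ^ j) $ n" for i j
  proof (cases "i + j \<le> n")
    case True
    have "((in_x logU + in_y logU) ^ K) $ j $ i = 0" if "K > i + j" for K
    proof -
      have "(homog_sum logU ^ K) $ (i + j) = 0"
        using startsby_zero_power_prefix[of "homog_sum logU" K] that
        by (simp add: homog_sum_def homog_y_def)
      then show ?thesis using homog_sum_power_nth[of j "i + j" logU K] by simp
    qed
    then have "(\<Sum>K\<le>n. expU $ K * ((in_x logU + in_y logU) ^ K) $ j $ i) = fglU i j"
      unfolding fglU_def using True by (intro sum.mono_neutral_right) auto
    then show ?thesis by simp
  next
    case False
    then have "(?P ^ i * fps_X ^ j) $ n = 0"
      using startsby_zero_power_prefix[OF P0, of i] by (auto simp: fps_X_power_mult_right_nth)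
    then show ?thesis by simp
  qed
  have inner: "(\<Sum>a\<le>K. of_nat (K choose a)
        * (\<Sum>i\<le>n. \<Sum>j\<le>n. (logU ^ a) $ i * (logU ^ (K - a)) $ j * (?P ^ i * fps_X ^ j) $ n))
      = (\<Sum>i\<le>n. \<Sum>j\<le>n. ((in_x logU + in_y logU) ^ K) $ j $ i * (?P ^ i * fps_X ^ j) $ n)" for K
  proof -
    have "(\<Sum>a\<le>K. of_nat (K choose a)
        * (\<Sum>i\<le>n. \<Sum>j\<le>n. (logU ^ a) $ i * (logU ^ (K - a)) $ j * (?P ^ i * fps_X ^ j) $ n))
      = (\<Sum>i\<le>n. \<Sum>a\<le>K. \<Sum>j\<le>n. of_nat (K choose a) * ((logU ^ a) $ i * (logU ^ (K - a)) $ j) * (?P ^ i * fps_X ^ j) $ n)"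
      by (subst sum.swap) (simp add: sum_distrib_left mult.assoc)
    also have "\<dots> = (\<Sum>i\<le>n. \<Sum>j\<le>n. \<Sum>a\<le>K. of_nat (K choose a) * ((logU ^ a) $ i * (logU ^ (K - a)) $ j) * (?P ^ i * fps_X ^ j) $ n)"
      by (rule sum.cong[OF refl sum.swap])
    finally show ?thesis
      by (simp only: in_xy_power_nth sum_distrib_right)
  qed
  have "powU (Suc k) = expU oo ((logU oo ?P) + logU)"
    unfolding logP by (simp add: powU_def distrib_right add.commute)
  then have "powU (Suc k) $ n = (\<Sum>K\<le>n. expU $ K * (((logU oo ?P) + logU) ^ K) $ n)"
    by (simp add: fps_compose_nth atMost_atLeast0)
  also have "\<dots> = (\<Sum>K\<le>n. expU $ K * (\<Sum>a\<le>K. of_nat (K choose a)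
      * (\<Sum>i\<le>n. \<Sum>j\<le>n. (logU ^ a) $ i * (logU ^ (K - a)) $ j * (?P ^ i * fps_X ^ j) $ n)))"
    unfolding binomial_ring fps_sum_nth mult.assoc nat_nth fps_compose_power[OF P0]
      compose_mult_nth[OF P0] ..
  also have "\<dots> = (\<Sum>K\<le>n. expU $ K * (\<Sum>i\<le>n. \<Sum>j\<le>n.
      ((in_x logU + in_y logU) ^ K) $ j $ i * (?P ^ i * fps_X ^ j) $ n))"
    by (simp only: inner)
  also have "\<dots> = (\<Sum>i\<le>n. \<Sum>K\<le>n. \<Sum>j\<le>n.
      expU $ K * ((in_x logU + in_y logU) ^ K) $ j $ i * (?P ^ i * fps_X ^ j) $ n)"
    by (subst sum.swap) (simp add: sum_distrib_left mult.assoc)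
  also have "\<dots> = (\<Sum>i\<le>n. \<Sum>j\<le>n. \<Sum>K\<le>n.
      expU $ K * ((in_x logU + in_y logU) ^ K) $ j $ i * (?P ^ i * fps_X ^ j) $ n)"
    by (rule sum.cong[OF refl sum.swap])
  also have "\<dots> = (\<Sum>i\<le>n. \<Sum>j\<le>n. fglU i j * (?P ^ i * fps_X ^ j) $ n)"
    by (simp only: sum_distrib_right[symmetric] fgl)
  finally show ?thesis .
qed

lemma powU_integral: "powU k \<in> coeffs_in OmegaU"
proof (induction k)
  case 0
  have "powU 0 = 0" by (simp add: powU_def expU_def fps_rev_def)
  then show ?case using subring_zero[OF coeffs_in_subring[OF OmegaU_subring]] by simp
next
  case (Suc k)
  have "fps_X \<in> coeffs_in OmegaU"
    using subring_zero[OF OmegaU_subring] subring_one[OF OmegaU_subring]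
    by (simp add: coeffs_in_def fps_X_def)
  then have "(powU k ^ i * fps_X ^ j) $ n \<in> OmegaU" for i j n
    using Suc coeffs_in_subring[OF OmegaU_subring]
    by (intro coeffs_inD[of _ OmegaU] subring_mult subring_power)
  then show ?case
    by (intro coeffs_inI) (auto simp: powU_Suc_nth
        intro!: subring_sum[OF OmegaU_subring] subring_mult[OF OmegaU_subring] fglU_in_OmegaU)
qed

section \<open>The subring of power operations\<close>

lemma powU_nth_1: "powU k $ 1 = of_nat k"
  using compose_nth_linear[OF powU_0, of 1 logU k] by (simp add: logU_powU flip: fps_of_nat)

lemma lookup_mult_0:
  fixes r x :: cobordism_rat
  assumes "Poly_Mapping.lookup x 0 = 0"
  shows "Poly_Mapping.lookup (r * x) 0 = 0"
proof (rule ccontr)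
  assume "Poly_Mapping.lookup (r * x) 0 \<noteq> 0"
  then have "0 \<in> Poly_Mapping.keys (r * x)" by (simp add: in_keys_iff)
  then obtain a b where ab: "0 = a + b" "b \<in> Poly_Mapping.keys x" using keys_mult by blast
  have "Poly_Mapping.lookup b i = 0" for i
    using arg_cong[OF ab(1), of "\<lambda>m. Poly_Mapping.lookup m i"] by (simp add: lookup_add)
  then have "b = 0" by (intro poly_mapping_eqI) simp
  then show False using ab(2) assms by (simp add: in_keys_iff)
qed

text \<open>An element of \<open>\<Lambda>(1)\<close> is an integer plus an element of the ideal on the right.  That ideal has no
  component of degree \<open>0\<close>, so the integer is the component of degree \<open>0\<close>.\<close>

lemma Lambda1_pos_subset: "Lambda1_pos \<subseteq> module_span OmegaU {powU k $ n | k n. n > 1}"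
proof
  let ?I = "module_span OmegaU {powU k $ n | k n. n > 1}"
  have I: "is_submodule OmegaU ?I" by (rule module_span_submodule)
  have const0: "?I \<subseteq> {x. Poly_Mapping.lookup x 0 = 0}"
  proof (rule module_span_minimal)
    show "is_submodule OmegaU {x :: cobordism_rat. Poly_Mapping.lookup x 0 = 0}"
      by (auto simp: is_submodule_def lookup_add lookup_mult_0)
    show "{powU k $ n | k n. n > 1} \<subseteq> {x. Poly_Mapping.lookup x 0 = 0}"
    proof
      fix x assume "x \<in> {powU k $ n | k n. n > 1}"
      then obtain k n where x: "x = powU k $ n" and n: "n > 1" by blast
      have "0 \<notin> Poly_Mapping.keys x"
        using weightD[OF weight_powU[of k], of 0 n] n unfolding x by fastforce
      then show "x \<in> {x. Poly_Mapping.lookup x 0 = 0}" by (simp add: in_keys_iff)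
    qed
  qed
  define T where "T = {x \<in> OmegaU. \<exists>c. x - of_int c \<in> ?I}"
  have "is_subring T"
    unfolding is_subring_def
  proof (intro conjI ballI)
    show "1 \<in> T"
      using subring_one[OF OmegaU_subring] submodule_zero[OF I]
      by (auto simp: T_def intro!: exI[of _ 1])
    fix x y assume "x \<in> T" "y \<in> T"
    then obtain c d where xy: "x \<in> OmegaU" "y \<in> OmegaU" "x - of_int c \<in> ?I" "y - of_int d \<in> ?I"
      by (auto simp: T_def)
    have "(x - y) - of_int (c - d) = (x - of_int c) - (y - of_int d)" by simp
    then have "(x - y) - of_int (c - d) \<in> ?I"
      using submodule_diff[OF I OmegaU_subring xy(3,4)] by (simp only:)
    then show "x - y \<in> T"
      using subring_diff[OF OmegaU_subring xy(1,2)] unfolding T_def by blast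
    have "x * y - of_int (c * d) \<in> ?I"
      unfolding of_int_mult using xy
      by (intro ideal_mult_cong[OF OmegaU_subring I] subring_of_int[OF OmegaU_subring])
    then show "x * y \<in> T"
      using subring_mult[OF OmegaU_subring xy(1,2)] unfolding T_def by blast
  qed
  moreover have "powU k $ i \<in> T" for k i
  proof -
    consider "i = 0" | "i = 1" | "i > 1" by linarith
    then have "\<exists>c. powU k $ i - of_int c \<in> ?I"
    proof cases
      case 1
      then show ?thesis using submodule_zero[OF I] by (intro exI[of _ 0]) (simp add: powU_0)
    next
      case 2
      then show ?thesis using submodule_zero[OF I] powU_nth_1[of k] by (intro exI[of _ "int k"]) simp
    next
      case 3
      then show ?thesis by (intro exI[of _ 0]) (auto intro!: module_span_inc)
    qed
    then show ?thesis using coeffs_inD[OF powU_integral] by (simp add: T_def)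
  qed
  ultimately have Lambda1: "Lambda1 \<subseteq> T"
    unfolding Lambda1_def by (intro hull_minimal) auto
  fix x assume x: "x \<in> Lambda1_pos"
  then obtain c where c: "x - of_int c \<in> ?I"
    using Lambda1 by (auto simp: Lambda1_pos_def T_def)
  have "0 \<notin> Poly_Mapping.keys x"
    using x by (force simp: Lambda1_pos_def)
  then have "Poly_Mapping.lookup x 0 = 0" by (simp add: in_keys_iff)
  moreover have "Poly_Mapping.lookup (x - of_int c) 0 = 0" using c const0 by blast
  ultimately have "(of_int c :: rat) = 0"
    by (simp add: lookup_minus lookup_of_int)
  then show "x \<in> ?I" using c by simp
qed

lemma powU_in_Lambda1_pos:
  assumes "k > 0" "n > 1"
  shows "powU k $ n \<in> Lambda1_pos"
proof -
  have "powU k $ n \<in> Lambda1"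
    unfolding Lambda1_def using assms by (intro hull_inc) auto
  moreover have "cdim m \<noteq> 0" if "m \<in> Poly_Mapping.keys (powU k $ n)" for m
    using weightD[OF weight_powU that] assms by simp
  ultimately show ?thesis by (simp add: Lambda1_pos_def)
qed

text \<open>The order of \<open>g\<close> modulo \<open>p\<close> is exactly \<open>p - 1\<close>, so \<open>g^(N-1)\<close> is not \<open>1\<close> modulo \<open>p\<close>.\<close>

lemma residue_primroot_power_diff_coprime:
  assumes p: "prime p" and g: "residue_primroot p g" and N: "N > 0" "\<not> (p - 1) dvd (N - 1)"
  shows "coprime (int g - int g ^ N) (int p)"
proof -
  have cop: "coprime p g" and ord: "ord p g = p - 1"
    using g p by (auto simp: residue_primroot_def totient_prime)
  have "\<not> [g ^ (N - 1) = 1] (mod p)"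
    using N(2) ord_divides[of g "N - 1" p] unfolding ord by blast
  then have "\<not> [int g ^ (N - 1) = 1] (mod int p)"
    by (metis cong_int_iff of_nat_1 of_nat_power)
  then have "\<not> int p dvd 1 - int g ^ (N - 1)"
    by (simp add: cong_iff_dvd_diff dvd_diff_commute)
  moreover have "\<not> int p dvd int g"
    using cop p by (metis coprime_absorb_left int_dvd_int_iff not_prime_unit)
  moreover have "int g - int g ^ N = int g * (1 - int g ^ (N - 1))"
    using N(1) by (cases N) (simp_all add: algebra_simps)
  ultimately have "\<not> int p dvd int g - int g ^ N"
    using p by (simp add: prime_dvd_mult_iff)
  then have "coprime (int p) (int g - int g ^ N)"
    using p by (intro prime_imp_coprime) auto
  then show ?thesis by (simp add: coprime_commute)
qed

theorem theorem3p1: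
  fixes p p\<^sub>1 :: nat and \<alpha> :: "nat \<Rightarrow> cobordism_rat"
  assumes "prime p" and "odd p"
    and "prime p\<^sub>1" and "residue_primroot p p\<^sub>1"
    and "\<And>n. n \<ge> 1 \<Longrightarrow> \<alpha> n = (if (p - 1) dvd n then alpha p n else alpha p\<^sub>1 n)"
  shows "(\<forall>n\<ge>1. \<alpha> n \<in> OmegaU_deg (- 2 * int n)) \<and>
         module_span (tensor_Z_at OmegaU p) {\<alpha> n | n. n \<ge> 1} = tensor_Z_at Lambda1_tilde p"
proof (intro conjI allI impI equalityI)
  define k where "k N = (if (p - 1) dvd (N - 1) then p else p\<^sub>1)" for N
  have \<alpha>: "\<alpha> n = powU (k (n + 1)) $ (n + 1)" if "n \<ge> 1" for n
    using assms(5)[OF that] by (simp add: alpha_def k_def)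
  have k_pos: "k N > 0" for N
    using assms(1,3) by (simp add: k_def prime_gt_0_nat)
  have set_eq: "{\<alpha> n | n. n \<ge> 1} = (\<lambda>N. powU (k N) $ N) ` {1<..}"
  proof (intro equalityI subsetI)
    fix x assume "x \<in> (\<lambda>N. powU (k N) $ N) ` {1<..}"
    then obtain N where N: "N > 1" "x = powU (k N) $ N" by auto
    then have "x = \<alpha> (N - 1)" using \<alpha>[of "N - 1"] by simp
    then show "x \<in> {\<alpha> n | n. n \<ge> 1}" using N(1) by (auto intro!: exI[of _ "N - 1"])
  qed (use \<alpha> in fastforce)
  obtain \<sigma> y where "hazewinkel \<sigma> p y"
    by (rule hazewinkel_generators[OF assms(1)])
  then interpret hazewinkel \<sigma> p y .
  let ?R = "tensor_Z_at OmegaU p"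
  have tilde: "is_submodule OmegaU Lambda1_tilde"
    unfolding Lambda1_tilde_def by (rule module_span_submodule)
  show "\<alpha> n \<in> OmegaU_deg (- 2 * int n)" if "n \<ge> 1" for n
  proof -
    have "cdim m = n" if "m \<in> Poly_Mapping.keys (powU (k (n + 1)) $ (n + 1))" for m
      using weightD[OF weight_powU that] by simp
    then show ?thesis
      using coeffs_inD[OF powU_integral] by (simp add: \<alpha>[OF that] OmegaU_deg_def)
  qed
  show "module_span ?R {\<alpha> n | n. n \<ge> 1} \<subseteq> tensor_Z_at Lambda1_tilde p"
  proof (rule module_span_minimal)
    have "is_submodule (scalar ` Z_at p) (tensor_Z_at Lambda1_tilde p)"
      unfolding tensor_Z_at_def by (rule module_span_submodule)
    then show "is_submodule ?R (tensor_Z_at Lambda1_tilde p)"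
      using tensor_Z_at_mult_closed[OF tilde] by (simp add: is_submodule_def)
    show "{\<alpha> n | n. n \<ge> 1} \<subseteq> tensor_Z_at Lambda1_tilde p"
      unfolding set_eq using powU_in_Lambda1_pos[OF k_pos]
        subset_tensor_Z_at[of Lambda1_tilde p] module_span_inc[of _ Lambda1_pos OmegaU]
      by (auto simp: Lambda1_tilde_def)
  qed
  let ?I = "module_span ?R {\<alpha> n | n. n \<ge> 1}"
  have I: "is_submodule ?R ?I" by (rule module_span_submodule)
  have "powU l $ N \<in> ?I" if "N > 1" for l N
    unfolding tensor_OmegaU_eq_coord_ring set_eq
    using that residue_primroot_power_diff_coprime[OF assms(1,4)]
    by (intro ideal_generated_by_powU) (auto simp: k_def)
  moreover have OmegaU_sub: "is_submodule OmegaU ?I"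
    by (rule submodule_restrict[OF I subset_tensor_Z_at])
  ultimately have "module_span OmegaU {powU l $ N | l N. N > 1} \<subseteq> ?I"
    by (intro module_span_minimal) auto
  then have "Lambda1_tilde \<subseteq> ?I"
    unfolding Lambda1_tilde_def
    using Lambda1_pos_subset OmegaU_sub by (intro module_span_minimal) auto
  moreover have "is_submodule (scalar ` Z_at p) ?I"
    by (rule submodule_restrict[OF I])
       (auto simp: tensor_OmegaU_eq_coord_ring scalar_in_coord_ring)
  ultimately show "tensor_Z_at Lambda1_tilde p \<subseteq> ?I"
    unfolding tensor_Z_at_def by (rule module_span_minimal)
qed

end
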